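(* Let $X$ be a set, let $\Omega$ be a set with five binary operations $\leftarrow,\rightarrow,\lhd,\rhd,\cdot:\Omega\times\Omega\to\Omega$, and let $\lambda=(\lambda_{\alpha,\beta})_{(\alpha,\beta)\in\Omega^2}$ be a family of elements of $\mathbf{k}$. Let $\mathbf{k}\mathcal{T}(X,\Omega)$ be the free $\mathbf{k}$-module on the $X$-angularly decorated $\Omega$-typed planar rooted trees, with the bilinear product $\diamond$ and the grafting operators $B^+_\omega$ ($\omega\in\Omega$) defined in the context, and let $i:X\to\mathbf{k}\mathcal{T}(X,\Omega)$ send $x$ to the tree $(|,x,|)$. The following conditions are equivalent: (a) $(\mathbf{k}\mathcal{T}(X,\Omega),\diamond,(B^+_\omega)_{\omega\in\Omega})$ together with the map $i$ is the free $\Omega$-Rota-Baxter algebra of weight $\lambda$ generated by $X$. (b) $(\mathbf{k}\mathcal{T}(X,\Omega),\diamond,(B^+_\omega)_{\omega\in\Omega})$ is an $\Omega$-Rota-Baxter algebra of weight $\lambda$. (c) $(\Omega,\leftarrow,\rightarrow,\lhd,\rhd,\cdot,\lambda)$ is a $\lambda$-extended triassociative semigroup ($\lambda$-ETS).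
   Context: $\mathbf{k}$ is a nonzero unitary commutative ring, the base ring of all modules, algebras and linear maps. **EDS.** A diassociative semigroup is $(\Omega,\leftarrow,\rightarrow)$ with, for all $\alpha,\beta,\gamma\in\Omega$: $(\alpha\leftarrow\beta)\leftarrow\gamma=\alpha\leftarrow(\beta\leftarrow\gamma)=\alpha\leftarrow(\beta\rightarrow\gamma)$; $(\alpha\rightarrow\beta)\leftarrow\gamma=\alpha\rightarrow(\beta\leftarrow\gamma)$; $(\alpha\rightarrow\beta)\rightarrow\gamma=(\alpha\leftarrow\beta)\rightarrow\gamma=\alpha\rightarrow(\beta\rightarrow\gamma)$. An extended diassociative semigroup (EDS) is $(\Omega,\leftarrow,\rightarrow,\lhd,\rhd)$ where $(\Omega,\leftarrow,\rightarrow)$ is a diassociative semigroup and, for all $\alpha,\beta,\gamma\in\Omega$: $\alpha\rhd(\beta\leftarrow\gamma)=\alpha\rhd\beta$; $(\alpha\rightarrow\beta)\lhd\gamma=\beta\lhd\gamma$; $(\alpha\lhd\beta)\leftarrow((\alpha\leftarrow\beta)\lhd\gamma)=\alpha\lhd(\beta\leftarrow\gamma)$; $(\alpha\lhd\beta)\lhd((\alpha\leftarrow\beta)\lhd\gamma)=\beta\lhd\gamma$; $(\alpha\lhd\beta)\rightarrow((\alpha\leftarrow\beta)\lhd\gamma)=\alpha\lhd(\beta\rightarrow\gamma)$; $(\alpha\lhd\beta)\rhd((\alpha\leftarrow\beta)\lhd\gamma)=\beta\rhd\gamma$; $(\alpha\rhd(\beta\rightarrow\gamma))\leftarrow(\beta\rhd\gamma)=(\alpha\leftarrow\beta)\rhd\gamma$;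 $(\alpha\rhd(\beta\rightarrow\gamma))\lhd(\beta\rhd\gamma)=\alpha\lhd\beta$; $(\alpha\rhd(\beta\rightarrow\gamma))\rightarrow(\beta\rhd\gamma)=(\alpha\rightarrow\beta)\rhd\gamma$; $(\alpha\rhd(\beta\rightarrow\gamma))\rhd(\beta\rhd\gamma)=\alpha\rhd\beta$. **$\lambda$-ETS.** $(\Omega,\leftarrow,\rightarrow,\lhd,\rhd,\cdot,\lambda)$ is a $\lambda$-extended triassociative semigroup ($\lambda$-ETS) if $(\Omega,\leftarrow,\rightarrow,\lhd,\rhd)$ is an EDS, $\cdot$ is a binary operation on $\Omega$, $\lambda=(\lambda_{\alpha,\beta})_{\alpha,\beta\in\Omega}$ is a family of elements of $\mathbf{k}$, and for all $\alpha,\beta,\gamma\in\Omega$: $\lambda_{\alpha\rightarrow\beta,\gamma}=\lambda_{\beta,\gamma}$; $\lambda_{\alpha\lhd\beta,(\alpha\leftarrow\beta)\lhd\gamma}=\lambda_{\beta,\gamma}$; $\lambda_{\alpha\leftarrow\beta,\gamma}=\lambda_{\alpha,\beta\rightarrow\gamma}$; $\lambda_{\alpha\rhd(\beta\rightarrow\gamma),\beta\rhd\gamma}=\lambda_{\alpha,\beta}$; $\lambda_{\alpha,\beta}=\lambda_{\alpha,\beta\leftarrow\gamma}$; $\lambda_{\alpha,\beta}\lambda_{\alpha\cdot\beta,\gamma}=\lambda_{\beta,\gamma}\lambda_{\alpha,\beta\cdot\gamma}$; and moreover: (1) if $\lambda_{\alpha\rightarrow\beta,\gamma}=\lambda_{\beta,\gamma}\neq0$,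 then $\alpha\rhd\beta=\alpha\rhd(\beta\cdot\gamma)$ and $(\alpha\rightarrow\beta)\cdot\gamma=\alpha\rightarrow(\beta\cdot\gamma)$; (2) if $\lambda_{\alpha\lhd\beta,(\alpha\leftarrow\beta)\lhd\gamma}=\lambda_{\beta,\gamma}\neq0$, then $(\alpha\lhd\beta)\cdot((\alpha\leftarrow\beta)\lhd\gamma)=\alpha\lhd(\beta\cdot\gamma)$ and $(\alpha\leftarrow\beta)\leftarrow\gamma=\alpha\leftarrow(\beta\cdot\gamma)$; (3) if $\lambda_{\alpha\rhd(\beta\rightarrow\gamma),\beta\rhd\gamma}=\lambda_{\alpha,\beta}\neq0$, then $\alpha\rightarrow(\beta\rightarrow\gamma)=(\alpha\cdot\beta)\rightarrow\gamma$ and $(\alpha\rhd(\beta\rightarrow\gamma))\cdot(\beta\rhd\gamma)=(\alpha\cdot\beta)\rhd\gamma$; (4) if $\lambda_{\alpha\leftarrow\beta,\gamma}=\lambda_{\alpha,\beta\rightarrow\gamma}\neq0$, then $(\alpha\leftarrow\beta)\cdot\gamma=\alpha\cdot(\beta\rightarrow\gamma)$ and $\alpha\lhd\beta=\beta\rhd\gamma$; (5) if $\lambda_{\alpha,\beta}=\lambda_{\alpha,\beta\leftarrow\gamma}\neq0$, then $(\alpha\cdot\beta)\lhd\gamma=\beta\lhd\gamma$ and $(\alpha\cdot\beta)\leftarrow\gamma=\alpha\cdot(\beta\leftarrow\gamma)$; (6) if $\lambda_{\alpha,\beta}\lambda_{\alpha\cdot\beta,\gamma}=\lambda_{\beta,\gamma}\lambda_{\alpha,\beta\cdot\gamma}\neq0$,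 then $(\alpha\cdot\beta)\cdot\gamma=\alpha\cdot(\beta\cdot\gamma)$. **$\Omega$-Rota-Baxter algebra.** For $\Omega$ a set with five binary operations and $\lambda$ a family in $\mathbf{k}$ indexed by $\Omega^2$ (no axioms required), an $\Omega$-Rota-Baxter algebra of weight $\lambda$ is a pair $(A,(P_\omega)_{\omega\in\Omega})$ with $A$ an associative (here unitary) $\mathbf{k}$-algebra and $P_\omega:A\to A$ linear maps such that for all $a,b\in A$, $\alpha,\beta\in\Omega$: $$P_\alpha(a)P_\beta(b)=P_{\alpha\rightarrow\beta}(P_{\alpha\rhd\beta}(a)b)+P_{\alpha\leftarrow\beta}(aP_{\alpha\lhd\beta}(b))+\lambda_{\alpha,\beta}P_{\alpha\cdot\beta}(ab).$$ Morphisms are (unitary) algebra morphisms commuting with all the $P_\omega$. That $(F,i)$ is the free one generated by $X$ means: $F$ is an $\Omega$-Rota-Baxter algebra of weight $\lambda$, and for every $\Omega$-Rota-Baxter algebra $R$ of weight $\lambda$ and every map $f:X\to R$ there is a unique morphism $\overline f:F\to R$ with $\overline f\circ i=f$. **Trees.** An $X$-angularly decorated $\Omega$-typed planar rooted tree is a planar rooted tree (root and leaves are viewed as edges; vertices with a single incoming edge are allowed), with at least one vertex, each angle (pair of adjacent incoming edges at a vertex) decorated by an element of $X$ and each internal edge (neither root nor leaf) decorated by an element of $\Omega$. The set $\mathcal{T}(X,\Omega)$ of these trees is described recursively: a tree is a sequence $T=(b_1,x_1,b_2,x_2,\ldots,x_n,b_{n+1})$ with $n\ge0$, $x_1,\dots,x_n\in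 X$, where each branch $b_j$ at the lowest vertex is either the trivial branch $|$ (a leaf) or a pair $(\alpha_j,T_j)$ with $T_j\in\mathcal{T}(X,\Omega)$ attached by an internal edge of type $\alpha_j\in\Omega$. Depth: $\mathrm{dep}(|)=0$, and $\mathrm{dep}(T)=1+\max_j \mathrm{dep}(T_j)$ (with $T_j=|$ if $b_j=|$). The grafting operator $B^+_\omega$ is the linear map with $B^+_\omega(T)=((\omega,T))$ (a new root vertex with a single branch, $T$ attached by an edge of type $\omega$). **Product.** $\diamond$ is bilinear and is defined on trees $T=(b_1,x_1,\ldots,x_m,b_{m+1})$ and $T'=(b'_1,y_1,\ldots,y_n,b'_{n+1})$ by induction on $\mathrm{dep}(T)+\mathrm{dep}(T')$: – if $b_{m+1}=|$ or $b'_1=|$, then $T\diamond T'=(b_1,x_1,\ldots,x_m,c,y_1,b'_2,\ldots,y_n,b'_{n+1})$, where $c=b'_1$ if $b_{m+1}=|$, and $c=b_{m+1}$ if $b'_1=|$ (so $c=|$ if both are $|$); – if $b_{m+1}=(\alpha,S)$ and $b'_1=(\beta,S')$, put $$E=B^+_{\alpha\rightarrow\beta}\big(B^+_{\alpha\rhd\beta}(S)\diamond S'\big)+B^+_{\alpha\leftarrow\beta}\big(S\diamond B^+_{\alpha\lhd\beta}(S')\big)+\lambda_{\alpha,\beta}B^+_{\alpha\cdot\beta}(S\diamond S')$$ and $T\diamond T'=\big((b_1,x_1,\ldots,x_m,|)\diamond E\big)\diamond(|,y_1,b'_2,\ldots,y_n,b'_{n+1})$, these outer products being given by the first rule.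
   Formalization: The set X is assumed nonempty; for X empty, (b) does not imply (c): take Ω={0,1}, λ=0, a←b=a, a→b=b, a▷b=a, a◁b=1−a, where the product is associative but the EDS axioms fail. *)

theory Defs
  imports "HOL-Algebra.Algebraic_Closure_Type" "HOL-Library.Poly_Mapping" "HOL-Library.FuncSet"
begin

section \<open>Sets with five operations and a weight, extended triassociative semigroups\<close>

text \<open>
  The arrows are written with harpoons, since the plain arrow denotes function sets.
  The base ring is the type \<^typ>\<open>'k\<close> of class \<^class>\<open>comm_ring_1\<close>, so it is nonzero.
\<close>

record ('w, 'k) omega = "'w partial_object" +
  lft :: "['w, 'w] \<Rightarrow> 'w" (infixl \<open>\<leftharpoonup>\<index>\<close> 70)
  rgt :: "['w, 'w] \<Rightarrow> 'w" (infixl \<open>\<rightharpoonup>\<index>\<close> 70)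
  ltri :: "['w, 'w] \<Rightarrow> 'w" (infixl \<open>\<triangleleft>\<index>\<close> 70)
  rtri :: "['w, 'w] \<Rightarrow> 'w" (infixl \<open>\<triangleright>\<index>\<close> 70)
  dot :: "['w, 'w] \<Rightarrow> 'w" (infixl \<open>\<bullet>\<index>\<close> 70)
  weight :: "['w, 'w] \<Rightarrow> 'k"

locale omega_set =
  fixes \<Omega> :: "('w, 'k::comm_ring_1) omega" (structure)
  assumes lft_closed: "\<lbrakk>\<alpha> \<in> carrier \<Omega>; \<beta> \<in> carrier \<Omega>\<rbrakk> \<Longrightarrow> \<alpha> \<leftharpoonup> \<beta> \<in> carrier \<Omega>"
    and rgt_closed: "\<lbrakk>\<alpha> \<in> carrier \<Omega>; \<beta> \<in> carrier \<Omega>\<rbrakk> \<Longrightarrow> \<alpha> \<rightharpoonup> \<beta> \<in> carrier \<Omega>"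
    and ltri_closed: "\<lbrakk>\<alpha> \<in> carrier \<Omega>; \<beta> \<in> carrier \<Omega>\<rbrakk> \<Longrightarrow> \<alpha> \<triangleleft> \<beta> \<in> carrier \<Omega>"
    and rtri_closed: "\<lbrakk>\<alpha> \<in> carrier \<Omega>; \<beta> \<in> carrier \<Omega>\<rbrakk> \<Longrightarrow> \<alpha> \<triangleright> \<beta> \<in> carrier \<Omega>"
    and dot_closed: "\<lbrakk>\<alpha> \<in> carrier \<Omega>; \<beta> \<in> carrier \<Omega>\<rbrakk> \<Longrightarrow> \<alpha> \<bullet> \<beta> \<in> carrier \<Omega>"

locale diassociative_semigroup = omega_set +
  assumes dias1: "\<lbrakk>\<alpha> \<in> carrier \<Omega>; \<beta> \<in> carrier \<Omega>; \<gamma> \<in> carrier \<Omega>\<rbrakk> \<Longrightarrow>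
      (\<alpha> \<leftharpoonup> \<beta>) \<leftharpoonup> \<gamma> = \<alpha> \<leftharpoonup> (\<beta> \<leftharpoonup> \<gamma>) \<and> \<alpha> \<leftharpoonup> (\<beta> \<leftharpoonup> \<gamma>) = \<alpha> \<leftharpoonup> (\<beta> \<rightharpoonup> \<gamma>)"
    and dias2: "\<lbrakk>\<alpha> \<in> carrier \<Omega>; \<beta> \<in> carrier \<Omega>; \<gamma> \<in> carrier \<Omega>\<rbrakk> \<Longrightarrow>
      (\<alpha> \<rightharpoonup> \<beta>) \<leftharpoonup> \<gamma> = \<alpha> \<rightharpoonup> (\<beta> \<leftharpoonup> \<gamma>)"
    and dias3: "\<lbrakk>\<alpha> \<in> carrier \<Omega>; \<beta> \<in> carrier \<Omega>; \<gamma> \<in> carrier \<Omega>\<rbrakk> \<Longrightarrow>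
      (\<alpha> \<rightharpoonup> \<beta>) \<rightharpoonup> \<gamma> = (\<alpha> \<leftharpoonup> \<beta>) \<rightharpoonup> \<gamma> \<and> (\<alpha> \<leftharpoonup> \<beta>) \<rightharpoonup> \<gamma> = \<alpha> \<rightharpoonup> (\<beta> \<rightharpoonup> \<gamma>)"

locale extended_diassociative_semigroup = diassociative_semigroup +
  assumes eds1: "\<lbrakk>\<alpha> \<in> carrier \<Omega>; \<beta> \<in> carrier \<Omega>; \<gamma> \<in> carrier \<Omega>\<rbrakk> \<Longrightarrow>
      \<alpha> \<triangleright> (\<beta> \<leftharpoonup> \<gamma>) = \<alpha> \<triangleright> \<beta>"
    and eds2: "\<lbrakk>\<alpha> \<in> carrier \<Omega>; \<beta> \<in> carrier \<Omega>; \<gamma> \<in> carrier \<Omega>\<rbrakk> \<Longrightarrow>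
      (\<alpha> \<rightharpoonup> \<beta>) \<triangleleft> \<gamma> = \<beta> \<triangleleft> \<gamma>"
    and eds3: "\<lbrakk>\<alpha> \<in> carrier \<Omega>; \<beta> \<in> carrier \<Omega>; \<gamma> \<in> carrier \<Omega>\<rbrakk> \<Longrightarrow>
      (\<alpha> \<triangleleft> \<beta>) \<leftharpoonup> ((\<alpha> \<leftharpoonup> \<beta>) \<triangleleft> \<gamma>) = \<alpha> \<triangleleft> (\<beta> \<leftharpoonup> \<gamma>)"
    and eds4: "\<lbrakk>\<alpha> \<in> carrier \<Omega>; \<beta> \<in> carrier \<Omega>; \<gamma> \<in> carrier \<Omega>\<rbrakk> \<Longrightarrow>
      (\<alpha> \<triangleleft> \<beta>) \<triangleleft> ((\<alpha> \<leftharpoonup> \<beta>) \<triangleleft> \<gamma>) = \<beta> \<triangleleft> \<gamma>"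
    and eds5: "\<lbrakk>\<alpha> \<in> carrier \<Omega>; \<beta> \<in> carrier \<Omega>; \<gamma> \<in> carrier \<Omega>\<rbrakk> \<Longrightarrow>
      (\<alpha> \<triangleleft> \<beta>) \<rightharpoonup> ((\<alpha> \<leftharpoonup> \<beta>) \<triangleleft> \<gamma>) = \<alpha> \<triangleleft> (\<beta> \<rightharpoonup> \<gamma>)"
    and eds6: "\<lbrakk>\<alpha> \<in> carrier \<Omega>; \<beta> \<in> carrier \<Omega>; \<gamma> \<in> carrier \<Omega>\<rbrakk> \<Longrightarrow>
      (\<alpha> \<triangleleft> \<beta>) \<triangleright> ((\<alpha> \<leftharpoonup> \<beta>) \<triangleleft> \<gamma>) = \<beta> \<triangleright> \<gamma>"
    and eds7: "\<lbrakk>\<alpha> \<in> carrier \<Omega>; \<beta> \<in> carrier \<Omega>; \<gamma> \<in> carrier \<Omega>\<rbrakk> \<Longrightarrow>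
      (\<alpha> \<triangleright> (\<beta> \<rightharpoonup> \<gamma>)) \<leftharpoonup> (\<beta> \<triangleright> \<gamma>) = (\<alpha> \<leftharpoonup> \<beta>) \<triangleright> \<gamma>"
    and eds8: "\<lbrakk>\<alpha> \<in> carrier \<Omega>; \<beta> \<in> carrier \<Omega>; \<gamma> \<in> carrier \<Omega>\<rbrakk> \<Longrightarrow>
      (\<alpha> \<triangleright> (\<beta> \<rightharpoonup> \<gamma>)) \<triangleleft> (\<beta> \<triangleright> \<gamma>) = \<alpha> \<triangleleft> \<beta>"
    and eds9: "\<lbrakk>\<alpha> \<in> carrier \<Omega>; \<beta> \<in> carrier \<Omega>; \<gamma> \<in> carrier \<Omega>\<rbrakk> \<Longrightarrow>
      (\<alpha> \<triangleright> (\<beta> \<rightharpoonup> \<gamma>)) \<rightharpoonup> (\<beta> \<triangleright> \<gamma>) = (\<alpha> \<rightharpoonup> \<beta>) \<triangleright> \<gamma>"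
    and eds10: "\<lbrakk>\<alpha> \<in> carrier \<Omega>; \<beta> \<in> carrier \<Omega>; \<gamma> \<in> carrier \<Omega>\<rbrakk> \<Longrightarrow>
      (\<alpha> \<triangleright> (\<beta> \<rightharpoonup> \<gamma>)) \<triangleright> (\<beta> \<triangleright> \<gamma>) = \<alpha> \<triangleright> \<beta>"

locale lambda_ETS = extended_diassociative_semigroup +
  assumes weight1: "\<lbrakk>\<alpha> \<in> carrier \<Omega>; \<beta> \<in> carrier \<Omega>; \<gamma> \<in> carrier \<Omega>\<rbrakk> \<Longrightarrow>
      weight \<Omega> (\<alpha> \<rightharpoonup> \<beta>) \<gamma> = weight \<Omega> \<beta> \<gamma>"
    and weight2: "\<lbrakk>\<alpha> \<in> carrier \<Omega>; \<beta> \<in> carrier \<Omega>; \<gamma> \<in> carrier \<Omega>\<rbrakk> \<Longrightarrow>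
      weight \<Omega> (\<alpha> \<triangleleft> \<beta>) ((\<alpha> \<leftharpoonup> \<beta>) \<triangleleft> \<gamma>) = weight \<Omega> \<beta> \<gamma>"
    and weight3: "\<lbrakk>\<alpha> \<in> carrier \<Omega>; \<beta> \<in> carrier \<Omega>; \<gamma> \<in> carrier \<Omega>\<rbrakk> \<Longrightarrow>
      weight \<Omega> (\<alpha> \<leftharpoonup> \<beta>) \<gamma> = weight \<Omega> \<alpha> (\<beta> \<rightharpoonup> \<gamma>)"
    and weight4: "\<lbrakk>\<alpha> \<in> carrier \<Omega>; \<beta> \<in> carrier \<Omega>; \<gamma> \<in> carrier \<Omega>\<rbrakk> \<Longrightarrow>
      weight \<Omega> (\<alpha> \<triangleright> (\<beta> \<rightharpoonup> \<gamma>)) (\<beta> \<triangleright> \<gamma>) = weight \<Omega> \<alpha> \<beta>"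
    and weight5: "\<lbrakk>\<alpha> \<in> carrier \<Omega>; \<beta> \<in> carrier \<Omega>; \<gamma> \<in> carrier \<Omega>\<rbrakk> \<Longrightarrow>
      weight \<Omega> \<alpha> \<beta> = weight \<Omega> \<alpha> (\<beta> \<leftharpoonup> \<gamma>)"
    and weight6: "\<lbrakk>\<alpha> \<in> carrier \<Omega>; \<beta> \<in> carrier \<Omega>; \<gamma> \<in> carrier \<Omega>\<rbrakk> \<Longrightarrow>
      weight \<Omega> \<alpha> \<beta> * weight \<Omega> (\<alpha> \<bullet> \<beta>) \<gamma> = weight \<Omega> \<beta> \<gamma> * weight \<Omega> \<alpha> (\<beta> \<bullet> \<gamma>)"
    and ets1: "\<lbrakk>\<alpha> \<in> carrier \<Omega>; \<beta> \<in> carrier \<Omega>; \<gamma> \<in> carrier \<Omega>; weight \<Omega> \<beta> \<gamma> \<noteq> 0\<rbrakk> \<Longrightarrow>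
      \<alpha> \<triangleright> \<beta> = \<alpha> \<triangleright> (\<beta> \<bullet> \<gamma>) \<and> (\<alpha> \<rightharpoonup> \<beta>) \<bullet> \<gamma> = \<alpha> \<rightharpoonup> (\<beta> \<bullet> \<gamma>)"
    and ets2: "\<lbrakk>\<alpha> \<in> carrier \<Omega>; \<beta> \<in> carrier \<Omega>; \<gamma> \<in> carrier \<Omega>; weight \<Omega> \<beta> \<gamma> \<noteq> 0\<rbrakk> \<Longrightarrow>
      (\<alpha> \<triangleleft> \<beta>) \<bullet> ((\<alpha> \<leftharpoonup> \<beta>) \<triangleleft> \<gamma>) = \<alpha> \<triangleleft> (\<beta> \<bullet> \<gamma>) \<and> (\<alpha> \<leftharpoonup> \<beta>) \<leftharpoonup> \<gamma> = \<alpha> \<leftharpoonup> (\<beta> \<bullet> \<gamma>)"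
    and ets3: "\<lbrakk>\<alpha> \<in> carrier \<Omega>; \<beta> \<in> carrier \<Omega>; \<gamma> \<in> carrier \<Omega>; weight \<Omega> \<alpha> \<beta> \<noteq> 0\<rbrakk> \<Longrightarrow>
      \<alpha> \<rightharpoonup> (\<beta> \<rightharpoonup> \<gamma>) = (\<alpha> \<bullet> \<beta>) \<rightharpoonup> \<gamma> \<and> (\<alpha> \<triangleright> (\<beta> \<rightharpoonup> \<gamma>)) \<bullet> (\<beta> \<triangleright> \<gamma>) = (\<alpha> \<bullet> \<beta>) \<triangleright> \<gamma>"
    and ets4: "\<lbrakk>\<alpha> \<in> carrier \<Omega>; \<beta> \<in> carrier \<Omega>; \<gamma> \<in> carrier \<Omega>; weight \<Omega> (\<alpha> \<leftharpoonup> \<beta>) \<gamma> \<noteq> 0\<rbrakk> \<Longrightarrow>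
      (\<alpha> \<leftharpoonup> \<beta>) \<bullet> \<gamma> = \<alpha> \<bullet> (\<beta> \<rightharpoonup> \<gamma>) \<and> \<alpha> \<triangleleft> \<beta> = \<beta> \<triangleright> \<gamma>"
    and ets5: "\<lbrakk>\<alpha> \<in> carrier \<Omega>; \<beta> \<in> carrier \<Omega>; \<gamma> \<in> carrier \<Omega>; weight \<Omega> \<alpha> \<beta> \<noteq> 0\<rbrakk> \<Longrightarrow>
      (\<alpha> \<bullet> \<beta>) \<triangleleft> \<gamma> = \<beta> \<triangleleft> \<gamma> \<and> (\<alpha> \<bullet> \<beta>) \<leftharpoonup> \<gamma> = \<alpha> \<bullet> (\<beta> \<leftharpoonup> \<gamma>)"
    and ets6: "\<lbrakk>\<alpha> \<in> carrier \<Omega>; \<beta> \<in> carrier \<Omega>; \<gamma> \<in> carrier \<Omega>;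
        weight \<Omega> \<alpha> \<beta> * weight \<Omega> (\<alpha> \<bullet> \<beta>) \<gamma> \<noteq> 0\<rbrakk> \<Longrightarrow>
      (\<alpha> \<bullet> \<beta>) \<bullet> \<gamma> = \<alpha> \<bullet> (\<beta> \<bullet> \<gamma>)"


section \<open>Rota-Baxter algebras\<close>

text \<open>
  The library locale \<^locale>\<open>algebra\<close> is for commutative algebras only.
  The base ring enters it as the record \<^const>\<open>ring_of_type_algebra\<close> built on the type \<^typ>\<open>'k\<close>.
\<close>

locale assoc_algebra = module + ring M +
  assumes smult_mult_left: "\<lbrakk>a \<in> carrier R; x \<in> carrier M; y \<in> carrier M\<rbrakk> \<Longrightarrow>
      (a \<odot>\<^bsub>M\<^esub> x) \<otimes>\<^bsub>M\<^esub> y = a \<odot>\<^bsub>M\<^esub> (x \<otimes>\<^bsub>M\<^esub> y)"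
    and smult_mult_right: "\<lbrakk>a \<in> carrier R; x \<in> carrier M; y \<in> carrier M\<rbrakk> \<Longrightarrow>
      x \<otimes>\<^bsub>M\<^esub> (a \<odot>\<^bsub>M\<^esub> y) = a \<odot>\<^bsub>M\<^esub> (x \<otimes>\<^bsub>M\<^esub> y)"

locale omega_rba =
  omega_set \<Omega> + assoc_algebra "ring_of_type_algebra :: 'k ring" A
  for \<Omega> :: "('w, 'k::comm_ring_1) omega" and A :: "('k, 'a) module"
    and P :: "'w \<Rightarrow> 'a \<Rightarrow> 'a" +
  assumes P_closed: "\<lbrakk>\<omega> \<in> carrier \<Omega>; a \<in> carrier A\<rbrakk> \<Longrightarrow> P \<omega> a \<in> carrier A"
    and P_add: "\<lbrakk>\<omega> \<in> carrier \<Omega>; a \<in> carrier A; b \<in> carrier A\<rbrakk> \<Longrightarrow>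
      P \<omega> (a \<oplus>\<^bsub>A\<^esub> b) = P \<omega> a \<oplus>\<^bsub>A\<^esub> P \<omega> b"
    and P_smult: "\<lbrakk>\<omega> \<in> carrier \<Omega>; a \<in> carrier A\<rbrakk> \<Longrightarrow> P \<omega> (c \<odot>\<^bsub>A\<^esub> a) = c \<odot>\<^bsub>A\<^esub> P \<omega> a"
    and rota_baxter:
      "\<lbrakk>\<alpha> \<in> carrier \<Omega>; \<beta> \<in> carrier \<Omega>; a \<in> carrier A; b \<in> carrier A\<rbrakk> \<Longrightarrow>
        P \<alpha> a \<otimes>\<^bsub>A\<^esub> P \<beta> b =
          P (\<alpha> \<rightharpoonup>\<^bsub>\<Omega>\<^esub> \<beta>) (P (\<alpha> \<triangleright>\<^bsub>\<Omega>\<^esub> \<beta>) a \<otimes>\<^bsub>A\<^esub> b)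
          \<oplus>\<^bsub>A\<^esub> P (\<alpha> \<leftharpoonup>\<^bsub>\<Omega>\<^esub> \<beta>) (a \<otimes>\<^bsub>A\<^esub> P (\<alpha> \<triangleleft>\<^bsub>\<Omega>\<^esub> \<beta>) b)
          \<oplus>\<^bsub>A\<^esub> weight \<Omega> \<alpha> \<beta> \<odot>\<^bsub>A\<^esub> P (\<alpha> \<bullet>\<^bsub>\<Omega>\<^esub> \<beta>) (a \<otimes>\<^bsub>A\<^esub> b)"

definition rba_hom ::
  "('w, 'k::comm_ring_1) omega \<Rightarrow> ('k, 'a) module \<Rightarrow> ('w \<Rightarrow> 'a \<Rightarrow> 'a) \<Rightarrow>
    ('k, 'b) module \<Rightarrow> ('w \<Rightarrow> 'b \<Rightarrow> 'b) \<Rightarrow> ('a \<Rightarrow> 'b) set"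
  where "rba_hom \<Omega> A P B Q =
    {g \<in> ring_hom A B.
      (\<forall>c. \<forall>a \<in> carrier A. g (c \<odot>\<^bsub>A\<^esub> a) = c \<odot>\<^bsub>B\<^esub> g a) \<and>
      (\<forall>\<omega> \<in> carrier \<Omega>. \<forall>a \<in> carrier A. g (P \<omega> a) = Q \<omega> (g a))}"

text \<open>
  A formula cannot quantify over types, so the type \<^typ>\<open>'r\<close> hosting the target algebras is a
  parameter; the full universal property is the conjunction over all \<^typ>\<open>'r\<close>.
  Extensionality makes uniqueness of \<^term>\<open>g\<close> mean uniqueness on the carrier.
\<close>

definition free_rba_on ::
  "'r itself \<Rightarrow> ('w, 'k::comm_ring_1) omega \<Rightarrow> 'x set \<Rightarrow> ('k, 'a) module \<Rightarrow>
    ('w \<Rightarrow> 'a \<Rightarrow> 'a) \<Rightarrow> ('x \<Rightarrow> 'a) \<Rightarrow> bool"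
  where "free_rba_on ty \<Omega> Gen F P i \<longleftrightarrow>
    omega_rba \<Omega> F P \<and> i \<in> Gen \<rightarrow> carrier F \<and>
    (\<forall>(R :: ('k, 'r) module) Q f. omega_rba \<Omega> R Q \<and> f \<in> Gen \<rightarrow> carrier R \<longrightarrow>
      (\<exists>!g. g \<in> rba_hom \<Omega> F P R Q \<and> g \<in> extensional (carrier F) \<and> (\<forall>x \<in> Gen. g (i x) = f x)))"


section \<open>Angularly decorated typed planar rooted trees\<close>

text \<open>
  The set of decorations of the angles is called \<open>Gen\<close>, as \<open>X\<close> is a syntax token of HOL-Algebra.
  The tree $(b_1,x_1,b_2,\ldots,x_n,b_{n+1})$ is \<open>Node b\<^sub>1 [(x\<^sub>1, b\<^sub>2), \<dots>, (x\<^sub>n, b\<^sub>n\<^sub>+\<^sub>1)]\<close>;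
  \<open>Leaf\<close> is the trivial branch.
\<close>

datatype (angles: 'x, edges: 'w) tree =
    Node "('x, 'w) branch" "('x \<times> ('x, 'w) branch) list"
and (angles_branch: 'x, edges_branch: 'w) branch =
    Leaf
  | Edge 'w "('x, 'w) tree"

definition trees :: "'w set \<Rightarrow> 'x set \<Rightarrow> ('x, 'w) tree set"
  where "trees W Gen = {T. angles T \<subseteq> Gen \<and> edges T \<subseteq> W}"

fun first_branch :: "('x, 'w) tree \<Rightarrow> ('x, 'w) branch"
  where "first_branch (Node b l) = b"

fun last_branch :: "('x, 'w) tree \<Rightarrow> ('x, 'w) branch"
  where "last_branch (Node b l) = (if l = [] then b else snd (last l))"

fun set_first :: "('x, 'w) branch \<Rightarrow> ('x, 'w) tree \<Rightarrow> ('x, 'w) tree"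
  where "set_first c (Node b l) = Node c l"

fun set_last :: "('x, 'w) branch \<Rightarrow> ('x, 'w) tree \<Rightarrow> ('x, 'w) tree"
  where "set_last c (Node b l) =
    (if l = [] then Node c [] else Node b (butlast l @ [(fst (last l), c)]))"

fun append_angles :: "('x, 'w) tree \<Rightarrow> ('x \<times> ('x, 'w) branch) list \<Rightarrow> ('x, 'w) tree"
  where "append_angles (Node b l) l' = Node b (l @ l')"

text \<open>
  The first rule of the product, meaningful when \<^term>\<open>last_branch T\<close> or
  \<^term>\<open>first_branch T'\<close> is \<^const>\<open>Leaf\<close>: the result is
  $(b_1,x_1,\ldots,x_m,c,y_1,b'_2,\ldots,y_n,b'_{n+1})$.
\<close>

fun tree_join :: "('x, 'w) tree \<Rightarrow> ('x, 'w) tree \<Rightarrow> ('x, 'w) tree"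
  where "tree_join T (Node b' l') =
    append_angles (set_last (if last_branch T = Leaf then b' else last_branch T) T) l'"

definition graft :: "'w \<Rightarrow> ('x, 'w) tree \<Rightarrow> ('x, 'w) tree"
  where "graft \<omega> T = Node (Edge \<omega> T) []"


section \<open>The free module on trees and its product\<close>

definition scale :: "'k::comm_ring_1 \<Rightarrow> ('a \<Rightarrow>\<^sub>0 'k) \<Rightarrow> ('a \<Rightarrow>\<^sub>0 'k)"
  where "scale c p = Poly_Mapping.map ((*) c) p"

definition lin_ext :: "('a \<Rightarrow> ('b \<Rightarrow>\<^sub>0 'k)) \<Rightarrow> ('a \<Rightarrow>\<^sub>0 'k::comm_ring_1) \<Rightarrow> ('b \<Rightarrow>\<^sub>0 'k)"
  where "lin_ext f p = (\<Sum>a\<in>Poly_Mapping.keys p. scale (Poly_Mapping.lookup p a) (f a))"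

definition tree_vec :: "('x, 'w) tree \<Rightarrow> (('x, 'w) tree \<Rightarrow>\<^sub>0 'k::comm_ring_1)"
  where "tree_vec T = Poly_Mapping.single T 1"

definition B_plus ::
  "'w \<Rightarrow> (('x, 'w) tree \<Rightarrow>\<^sub>0 'k::comm_ring_1) \<Rightarrow> (('x, 'w) tree \<Rightarrow>\<^sub>0 'k)"
  where "B_plus \<omega> = lin_ext (\<lambda>T. tree_vec (graft \<omega> T))"

lemma size_last_branch: "size (last_branch T) < size T"
proof (cases T)
  case (Node b l)
  show ?thesis
  proof (cases "l = []")
    case False
    then have "size_prod (\<lambda>_. 0) size (last l) \<le> size_list (size_prod (\<lambda>_. 0) size) l"
      by (intro size_list_estimation') auto
    then show ?thesis using Node False by (cases "last l") auto
  qed (use Node in simp)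
qed

lemma size_first_branch: "size (first_branch T) < size T"
  by (cases T) simp

function diamond ::
  "('w, 'k::comm_ring_1) omega \<Rightarrow> ('x, 'w) tree \<Rightarrow> ('x, 'w) tree \<Rightarrow> (('x, 'w) tree \<Rightarrow>\<^sub>0 'k)"
  where "diamond \<Omega> T T' =
    (case last_branch T of
       Leaf \<Rightarrow> tree_vec (tree_join T T')
     | Edge \<alpha> S \<Rightarrow>
       (case first_branch T' of
          Leaf \<Rightarrow> tree_vec (tree_join T T')
        | Edge \<beta> S' \<Rightarrow>
          lin_ext (\<lambda>U. tree_vec (tree_join (tree_join (set_last Leaf T) U) (set_first Leaf T')))
            (B_plus (\<alpha> \<rightharpoonup>\<^bsub>\<Omega>\<^esub> \<beta>) (diamond \<Omega> (graft (\<alpha> \<triangleright>\<^bsub>\<Omega>\<^esub> \<beta>) S) S')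
             + B_plus (\<alpha> \<leftharpoonup>\<^bsub>\<Omega>\<^esub> \<beta>) (diamond \<Omega> S (graft (\<alpha> \<triangleleft>\<^bsub>\<Omega>\<^esub> \<beta>) S'))
             + scale (weight \<Omega> \<alpha> \<beta>) (B_plus (\<alpha> \<bullet>\<^bsub>\<Omega>\<^esub> \<beta>) (diamond \<Omega> S S')))))"
  by pat_completeness auto
termination
proof (relation "measure (\<lambda>(\<Omega>, T, T'). size T + size T')", goal_cases)
  case 1
  show ?case by simp
next
  case (2 \<Omega> T T' \<alpha> S \<beta> S')
  then show ?case
    using size_last_branch[of T] size_first_branch[of T'] by (simp add: graft_def)
next
  case (3 \<Omega> T T' \<alpha> S \<beta> S')
  then show ?case
    using size_last_branch[of T] size_first_branch[of T'] by (simp add: graft_def)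
next
  case (4 \<Omega> T T' \<alpha> S \<beta> S')
  then show ?case
    using size_last_branch[of T] size_first_branch[of T'] by simp
qed

declare diamond.simps [simp del]

text \<open>
  The unit is the tree with one vertex and no angle; the carrier restricts the decorations to
  the given sets.
\<close>

definition tree_algebra ::
  "('w, 'k::comm_ring_1) omega \<Rightarrow> 'x set \<Rightarrow> ('k, ('x, 'w) tree \<Rightarrow>\<^sub>0 'k) module"
  where "tree_algebra \<Omega> Gen =
    \<lparr>carrier = {p. Poly_Mapping.keys p \<subseteq> trees (carrier \<Omega>) Gen},
     monoid.mult = (\<lambda>p q. lin_ext (\<lambda>T. lin_ext (diamond \<Omega> T) q) p),
     one = tree_vec (Node Leaf []),
     zero = 0,
     add = (+),
     module.smult = scale\<rparr>"

definition tree_gen :: "'x \<Rightarrow> (('x, 'w) tree \<Rightarrow>\<^sub>0 'k::comm_ring_1)"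
  where "tree_gen x = tree_vec (Node Leaf [(x, Leaf)])"

end

theory Submission
  imports Defs
begin

text \<open>
  Splitting a tree at an angle writes it as \<open>tree_cat U x V\<close>, and the product only affects the
  end of the word adjacent to the other factor.  Hence associativity reduces to triples
  $B^+_\<alpha>(a), B^+_\<beta>(b), B^+_\<gamma>(c)$.  There the recursive rule, together with associativity for
  smaller triples, turns both bracketings into sums of eleven terms, which the axioms of a
  $\<lambda>$-ETS match one by one.  Conversely, for $a = b = c = (|,x,|)$ these eleven terms are
  basis elements of distinct shapes, so that associativity forces each axiom.  The
  Rota-Baxter identity is the recursive rule itself, and a map on the generators extends
  to trees by evaluating them as words.
\<close>

section \<open>Linear maps on free modules\<close>

text \<open>The obstacle in the induction for associativity is that \<triangleright> and
  \<triangleleft> relabel the grafts that survive one use of the recursive rule. The induction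
  hypothesis is therefore needed for the same subtrees under all labels, and the measure is the
  total size of the three trees: relabelling leaves it unchanged, while every product left over has
  lost at least one graft. The axioms speak only of labels in the carrier, whereas the vectors live
  in the free module on all trees of the type; hence the bounds on supports, and the need to show
  that the product preserves them. Freeness and the axioms on labels are tied to the Rota-Baxter
  property separately: evaluation in a target algebra follows the recursion of the product by means
  of the identities of the target, so (b) gives (a) without passing through (c). Condition (c) is
  recovered by testing the product on trees built from a single generator, which is where a
  generator has to exist.\<close>

lemma lookup_scale [simp]: "Poly_Mapping.lookup (scale c p) a = c * Poly_Mapping.lookup p a"
  by (simp add: scale_def Poly_Mapping.map.rep_eq when_def)

lemma keys_scale: "Poly_Mapping.keys (scale c p) \<subseteq> Poly_Mapping.keys p"
  by (auto simp: in_keys_iff)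

lemma scale_0_left [simp]: "scale 0 p = 0"
  by (rule poly_mapping_eqI) simp

lemma scale_0_right [simp]: "scale c 0 = 0"
  by (rule poly_mapping_eqI) simp

lemma scale_1 [simp]: "scale 1 p = p"
  by (rule poly_mapping_eqI) simp

lemma scale_scale [simp]: "scale c (scale d p) = scale (c * d) p"
  by (rule poly_mapping_eqI) (simp add: mult.assoc)

lemma scale_add_right: "scale c (p + q) = scale c p + scale c q"
  by (rule poly_mapping_eqI) (simp add: lookup_add distrib_left)

lemma scale_add_left: "scale (c + d) p = scale c p + scale d p"
  by (rule poly_mapping_eqI) (simp add: lookup_add distrib_right)

text \<open>The support grows by one basis element at a time, and \<open>update\<close> at a fresh
  key adds a multiple of that element. Keeping supports inside \<open>S\<close> at every stage makes
  the principle usable for properties known only for trees with admissible decorations.\<close>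

lemma free_module_induct [consumes 1, case_names zero basis scale add]:
  assumes "Poly_Mapping.keys p \<subseteq> S"
    and zero: "P 0"
    and basis: "\<And>a. a \<in> S \<Longrightarrow> P (Poly_Mapping.single a 1)"
    and scale: "\<And>c p. \<lbrakk>Poly_Mapping.keys p \<subseteq> S; P p\<rbrakk> \<Longrightarrow> P (scale c p)"
    and add: "\<And>p q. \<lbrakk>Poly_Mapping.keys p \<subseteq> S; Poly_Mapping.keys q \<subseteq> S; P p; P q\<rbrakk> \<Longrightarrow> P (p + q)"
  shows "P p"
proof -
  have "Poly_Mapping.keys p \<subseteq> S \<longrightarrow> P p"
  proof (induction p rule: update_induct)
    case const
    show ?case by (simp add: zero)
  next
    case (update p a c)
    have "Poly_Mapping.update a c p = p + scale c (Poly_Mapping.single a 1)"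
      using update.hyps
      by (intro poly_mapping_eqI)
        (auto simp: Poly_Mapping.update.rep_eq lookup_add lookup_single when_def in_keys_iff)
    moreover have "P (p + scale c (Poly_Mapping.single a 1))"
      if "insert a (Poly_Mapping.keys p) \<subseteq> S"
    proof (rule add)
      show "Poly_Mapping.keys (scale c (Poly_Mapping.single a 1)) \<subseteq> S"
        using that keys_scale by fastforce
    qed (use that update.IH in \<open>auto intro: scale basis\<close>)
    moreover have "Poly_Mapping.keys (Poly_Mapping.update a c p) = insert a (Poly_Mapping.keys p)"
      using update.hyps by (simp add: keys_update)
    ultimately show ?case by simp
  qed
  with assms(1) show ?thesis by simp
qed

text \<open>Supports vary with the vector and can shrink under addition or, in the presence of zero
  divisors, under scaling. Over a common finite index set the sums can be compared term by
  term.\<close>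

lemma lin_ext_superset:
  assumes "finite A" "Poly_Mapping.keys p \<subseteq> A"
  shows "lin_ext f p = (\<Sum>a\<in>A. scale (Poly_Mapping.lookup p a) (f a))"
  unfolding lin_ext_def using assms
  by (intro sum.mono_neutral_left) (auto simp: in_keys_iff)

lemma lin_ext_0 [simp]: "lin_ext f 0 = 0"
  by (simp add: lin_ext_def)

lemma lin_ext_single: "lin_ext f (Poly_Mapping.single a c) = scale c (f a)"
  by (subst lin_ext_superset[where A = "{a}"]) auto

lemma lin_ext_add: "lin_ext f (p + q) = lin_ext f p + lin_ext f q"
proof -
  let ?A = "Poly_Mapping.keys p \<union> Poly_Mapping.keys q"
  have "lin_ext f r = (\<Sum>a\<in>?A. scale (Poly_Mapping.lookup r a) (f a))" if "r \<in> {p, q, p + q}" for r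
    using that keys_add[of p q] by (intro lin_ext_superset) auto
  then show ?thesis
    by (simp add: lookup_add scale_add_left sum.distrib)
qed

lemma scale_sum: "scale c (\<Sum>a\<in>A. f a) = (\<Sum>a\<in>A. scale c (f a))"
  by (induction A rule: infinite_finite_induct) (simp_all add: scale_add_right)

lemma lin_ext_scale: "lin_ext f (scale c p) = scale c (lin_ext f p)"
proof -
  have "lin_ext f (scale c p)
      = (\<Sum>a\<in>Poly_Mapping.keys p. scale (Poly_Mapping.lookup (scale c p) a) (f a))"
    by (rule lin_ext_superset[OF _ keys_scale]) simp
  then show ?thesis by (simp add: lin_ext_def scale_sum)
qed

text \<open>Linearity is required on the whole type, since product and grafting are linear on trees
  with arbitrary decorations; the carriers enter only through supports.\<close>

definition free_linear :: "(('a \<Rightarrow>\<^sub>0 'k::comm_ring_1) \<Rightarrow> ('b \<Rightarrow>\<^sub>0 'k)) \<Rightarrow> bool"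
  where "free_linear F \<longleftrightarrow>
    (\<forall>p q. F (p + q) = F p + F q) \<and> (\<forall>c p. F (scale c p) = scale c (F p))"

lemma free_linear_lin_ext [simp]: "free_linear (lin_ext f)"
  by (simp add: free_linear_def lin_ext_add lin_ext_scale)

lemma free_linear_compose: "free_linear F \<Longrightarrow> free_linear G \<Longrightarrow> free_linear (\<lambda>p. F (G p))"
  by (simp add: free_linear_def)

lemma free_linear_id: "free_linear (\<lambda>p. p)"
  by (simp add: free_linear_def)

text \<open>Homogeneity exchanges the scalar with the coefficients of \<open>p\<close>, so it rests
  on commutativity of the base ring. This is what makes the product linear in its right
  factor.\<close>

lemma free_linear_lin_ext_param:
  assumes "\<And>a. free_linear (\<lambda>q. F q a)"
  shows "free_linear (\<lambda>q. lin_ext (F q) p)"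
  using assms
  by (simp add: free_linear_def lin_ext_def scale_add_right sum.distrib scale_sum mult.commute)

lemma free_linear_eqI:
  assumes "free_linear F" "free_linear G" "Poly_Mapping.keys p \<subseteq> S"
    and "\<And>a. a \<in> S \<Longrightarrow> F (Poly_Mapping.single a 1) = G (Poly_Mapping.single a 1)"
  shows "F p = G p"
  using assms(3)
proof (induction rule: free_module_induct)
  case zero
  have "F 0 = 0" "G 0 = 0"
    using assms(1,2) scale_0_left unfolding free_linear_def by metis+
  then show ?case by simp
qed (use assms in \<open>auto simp: free_linear_def\<close>)

lemma lin_ext_lin_ext: "lin_ext f (lin_ext g p) = lin_ext (\<lambda>a. lin_ext f (g a)) p"
  by (rule free_linear_eqI[where S = UNIV])
    (auto intro: free_linear_compose[of "lin_ext f" "lin_ext g"] simp: lin_ext_single)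

lemma lin_ext_single_id: "lin_ext (\<lambda>a. Poly_Mapping.single a 1) p = p"
  by (rule free_linear_eqI[where S = UNIV]) (auto simp: lin_ext_single free_linear_id)

lemma keys_lin_ext:
  assumes "Poly_Mapping.keys p \<subseteq> S" "\<And>a. a \<in> S \<Longrightarrow> Poly_Mapping.keys (f a) \<subseteq> S'"
  shows "Poly_Mapping.keys (lin_ext f p) \<subseteq> S'"
  using assms(1)
proof (induction rule: free_module_induct)
  case (scale c p)
  then show ?case by (simp add: lin_ext_scale order_trans[OF keys_scale])
next
  case (add p q)
  then show ?case by (simp add: lin_ext_add order_trans[OF keys_add])
qed (use assms(2) in \<open>auto simp: lin_ext_single\<close>)


section \<open>Trees as words\<close>

text \<open>Both branches next to \<open>x\<close> survive, unlike in \<open>tree_join\<close>,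
  which merges two branches into one. In the algebra this is the product of \<open>U\<close>, the
  generator of \<open>x\<close> and \<open>V\<close>, but it is defined without recourse to the
  recursive product.\<close>

fun tree_cat :: "('x, 'w) tree \<Rightarrow> 'x \<Rightarrow> ('x, 'w) tree \<Rightarrow> ('x, 'w) tree"
  where "tree_cat (Node b l) x (Node b' l') = Node b (l @ (x, b') # l')"

abbreviation tree_unit :: "('x, 'w) tree"
  where "tree_unit \<equiv> Node Leaf []"

lemma size_tree_cat [simp]: "size U < size (tree_cat U x V)" "size V < size (tree_cat U x V)"
  by (cases U; cases V; simp)+

lemma size_graft [simp]: "size (graft \<omega> S) = size S + 2"
  by (simp add: graft_def)

lemma tree_cases [case_names unit graft cat]:
  obtains "T = tree_unit" | \<omega> S where "T = graft \<omega> S" | U x V where "T = tree_cat U x V"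
proof (cases T)
  case (Node b l)
  show ?thesis
  proof (cases l)
    case Nil
    then show ?thesis using Node that by (cases b) (auto simp: graft_def)
  next
    case (Cons xb l')
    then have "T = tree_cat (Node b []) (fst xb) (Node (snd xb) l')" using Node by simp
    then show ?thesis using that by blast
  qed
qed

lemma trees_unit [simp]: "tree_unit \<in> trees W Gen"
  by (simp add: trees_def)

lemma trees_graft [simp]: "graft \<omega> S \<in> trees W Gen \<longleftrightarrow> \<omega> \<in> W \<and> S \<in> trees W Gen"
  by (auto simp: trees_def graft_def)

lemma trees_cat [simp]:
  "tree_cat U x V \<in> trees W Gen \<longleftrightarrow> U \<in> trees W Gen \<and> x \<in> Gen \<and> V \<in> trees W Gen"
  by (cases U; cases V) (auto simp: trees_def)

text \<open>Takes the place of structural induction on the nested datatype. The three cases are the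
  operations that generate the algebra: unit, grafting, and multiplication through a
  generator.\<close>

lemma trees_induct [consumes 1, case_names unit graft cat]:
  assumes "T \<in> trees W Gen"
    and "P tree_unit"
    and "\<And>\<omega> S. \<lbrakk>\<omega> \<in> W; S \<in> trees W Gen; P S\<rbrakk> \<Longrightarrow> P (graft \<omega> S)"
    and "\<And>U x V. \<lbrakk>U \<in> trees W Gen; x \<in> Gen; V \<in> trees W Gen; P U; P V\<rbrakk> \<Longrightarrow> P (tree_cat U x V)"
  shows "P T"
  using assms(1)
proof (induction "size T" arbitrary: T rule: less_induct)
  case less
  show ?case
  proof (cases T rule: tree_cases)
    case unit
    then show ?thesis using assms(2) by simp
  next
    case (graft \<omega> S)
    then show ?thesis using less assms(3) by simp
  next
    case (cat U x V)
    then show ?thesis using less assms(4) by simp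
  qed
qed

lemma first_branch_cat [simp]: "first_branch (tree_cat U x V) = first_branch U"
  by (cases U; cases V) simp

lemma last_branch_cat [simp]: "last_branch (tree_cat U x V) = last_branch V"
  by (cases U; cases V) simp

lemma set_first_cat: "set_first c (tree_cat U x V) = tree_cat (set_first c U) x V"
  by (cases U; cases V) simp

lemma set_last_cat: "set_last c (tree_cat U x V) = tree_cat U x (set_last c V)"
  by (cases U; cases V) (auto simp: butlast_append)

lemma append_angles_cat: "append_angles (tree_cat U x V) l = tree_cat U x (append_angles V l)"
  by (cases U; cases V) simp

lemma append_angles_eq_cat: "append_angles U (l @ (x, b) # l') = tree_cat (append_angles U l) x (Node b l')"
  by (cases U) simp

lemma tree_join_cat_right: "tree_join T (tree_cat U x V) = tree_cat (tree_join T U) x V"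
  by (cases U; cases V) (simp add: append_angles_eq_cat)

lemma tree_join_cat_left: "tree_join (tree_cat U x V) T = tree_cat U x (tree_join V T)"
  by (cases T) (simp add: set_last_cat append_angles_cat)

lemma tree_join_unit_left [simp]: "tree_join tree_unit T = T"
  by (cases T) simp

lemma append_angles_Nil [simp]: "append_angles T [] = T"
  by (cases T) simp

lemma set_last_last_branch [simp]: "set_last (last_branch T) T = T"
  by (cases T) simp

lemma tree_join_unit_right [simp]: "tree_join T tree_unit = T"
  by (cases "last_branch T = Leaf") (simp_all, metis set_last_last_branch)

text \<open>One unfolding of the recursion on both sides is enough, with no induction: the rule
  inspects only the last branch of \<open>T\<close> and the first branch of the right factor, which
  is that of \<open>U\<close>, and the outer joins commute with appending \<open>x\<close> and
  \<open>V\<close>. \<open>diamond_cat_left\<close> is the mirror image.\<close>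

lemma diamond_cat_right:
  "diamond \<Omega> T (tree_cat U x V) = lin_ext (\<lambda>W. tree_vec (tree_cat W x V)) (diamond \<Omega> T U)"
  by (subst (1 2) diamond.simps)
    (auto split: branch.splits simp: tree_vec_def lin_ext_single lin_ext_lin_ext
      tree_join_cat_right set_first_cat)

lemma diamond_cat_left:
  "diamond \<Omega> (tree_cat U x V) T = lin_ext (\<lambda>W. tree_vec (tree_cat U x W)) (diamond \<Omega> V T)"
  by (subst (1 2) diamond.simps)
    (auto split: branch.splits simp: tree_vec_def lin_ext_single lin_ext_lin_ext
      tree_join_cat_left set_last_cat)

lemma diamond_unit_left [simp]: "diamond \<Omega> tree_unit T = tree_vec T"
  by (subst diamond.simps) simp

lemma diamond_unit_right [simp]: "diamond \<Omega> T tree_unit = tree_vec T"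
  by (subst diamond.simps) (simp del: tree_join.simps split: branch.split)

section \<open>The product as a bilinear map\<close>

definition tree_mult ::
  "('w, 'k::comm_ring_1) omega \<Rightarrow> (('x, 'w) tree \<Rightarrow>\<^sub>0 'k) \<Rightarrow> (('x, 'w) tree \<Rightarrow>\<^sub>0 'k)
    \<Rightarrow> (('x, 'w) tree \<Rightarrow>\<^sub>0 'k)"
  where "tree_mult \<Omega> p q = lin_ext (\<lambda>T. lin_ext (diamond \<Omega> T) q) p"

lemma free_linear_mult_left: "free_linear (\<lambda>p. tree_mult \<Omega> p q)"
  unfolding tree_mult_def by simp

lemma free_linear_mult_right: "free_linear (tree_mult \<Omega> p)"
  unfolding tree_mult_def by (rule free_linear_lin_ext_param) simp

lemma tree_mult_linear:
  "tree_mult \<Omega> (p + p') q = tree_mult \<Omega> p q + tree_mult \<Omega> p' q"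
  "tree_mult \<Omega> (scale c p) q = scale c (tree_mult \<Omega> p q)"
  "tree_mult \<Omega> p (q + q') = tree_mult \<Omega> p q + tree_mult \<Omega> p q'"
  "tree_mult \<Omega> p (scale c q) = scale c (tree_mult \<Omega> p q)"
  using free_linear_mult_left[of \<Omega> q] free_linear_mult_right[of \<Omega> p]
  by (auto simp: free_linear_def)

lemma keys_tree_vec [simp]: "Poly_Mapping.keys (tree_vec T :: _ \<Rightarrow>\<^sub>0 'k::comm_ring_1) = {T}"
  by (simp add: tree_vec_def)

lemma lin_ext_vec [simp]: "lin_ext f (tree_vec T) = f T"
  by (simp add: tree_vec_def lin_ext_single)

lemma tree_mult_vec: "tree_mult \<Omega> (tree_vec T) (tree_vec T') = diamond \<Omega> T T'"
  by (simp add: tree_mult_def tree_vec_def lin_ext_single)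

lemma tree_mult_unit [simp]:
  fixes p :: "('x, 'w) tree \<Rightarrow>\<^sub>0 'k::comm_ring_1"
  shows "tree_mult \<Omega> (tree_vec tree_unit) p = p" "tree_mult \<Omega> p (tree_vec tree_unit) = p"
proof -
  have "diamond \<Omega> tree_unit = (\<lambda>T :: ('x, 'w) tree. Poly_Mapping.single T 1)"
    by (rule ext) (simp add: tree_vec_def)
  then show "tree_mult \<Omega> (tree_vec tree_unit) p = p" "tree_mult \<Omega> p (tree_vec tree_unit) = p"
    by (simp_all add: tree_mult_def tree_vec_def lin_ext_single lin_ext_single_id)
qed

lemma free_linear_B_plus: "free_linear (B_plus \<omega>)"
  by (simp add: B_plus_def)

lemma B_plus_linear:
  "B_plus \<omega> (p + q) = B_plus \<omega> p + B_plus \<omega> q" "B_plus \<omega> (scale c p) = scale c (B_plus \<omega> p)"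
  using free_linear_B_plus[of \<omega>] by (auto simp: free_linear_def)

lemma B_plus_vec: "B_plus \<omega> (tree_vec T) = tree_vec (graft \<omega> T)"
  by (simp add: B_plus_def tree_vec_def lin_ext_single)

text \<open>Removing the only branch leaves the one-vertex tree on either side, so the two outer
  joins of the recursive rule are trivial and only the sum of three grafted terms remains.\<close>

lemma diamond_graft:
  "diamond \<Omega> (graft \<alpha> S) (graft \<beta> S') =
     B_plus (\<alpha> \<rightharpoonup>\<^bsub>\<Omega>\<^esub> \<beta>) (diamond \<Omega> (graft (\<alpha> \<triangleright>\<^bsub>\<Omega>\<^esub> \<beta>) S) S')
     + B_plus (\<alpha> \<leftharpoonup>\<^bsub>\<Omega>\<^esub> \<beta>) (diamond \<Omega> S (graft (\<alpha> \<triangleleft>\<^bsub>\<Omega>\<^esub> \<beta>) S'))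
     + scale (weight \<Omega> \<alpha> \<beta>) (B_plus (\<alpha> \<bullet>\<^bsub>\<Omega>\<^esub> \<beta>) (diamond \<Omega> S S'))"
proof -
  have ends: "last_branch (graft \<alpha> S) = Edge \<alpha> S" "first_branch (graft \<beta> S') = Edge \<beta> S'"
    "set_last Leaf (graft \<alpha> S) = tree_unit" "set_first Leaf (graft \<beta> S') = tree_unit"
    by (simp_all add: graft_def)
  show ?thesis
    by (subst diamond.simps) (simp add: ends tree_vec_def lin_ext_single_id del: tree_join.simps)
qed

lemma free_bilinear_eqI:
  assumes "\<And>q. free_linear (\<lambda>p. F p q)" "\<And>q. free_linear (\<lambda>p. G p q)"
    and "\<And>p. free_linear (F p)" "\<And>p. free_linear (G p)"
    and "\<And>a b. F (Poly_Mapping.single a 1) (Poly_Mapping.single b 1)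
      = G (Poly_Mapping.single a 1) (Poly_Mapping.single b 1)"
  shows "F p q = G p q"
proof -
  have "F (Poly_Mapping.single a 1) q = G (Poly_Mapping.single a 1) q" for a
    using assms by (auto intro: free_linear_eqI[of "F (Poly_Mapping.single a 1)" _ q UNIV])
  then show ?thesis
    using assms by (auto intro: free_linear_eqI[of "\<lambda>p. F p q" "\<lambda>p. G p q" p UNIV])
qed

text \<open>The Rota-Baxter identity holds for every \<open>\<Omega>\<close>: it is the recursive rule of the product.\<close>

lemma tree_mult_B_plus:
  "tree_mult \<Omega> (B_plus \<alpha> p) (B_plus \<beta> q) =
     B_plus (\<alpha> \<rightharpoonup>\<^bsub>\<Omega>\<^esub> \<beta>) (tree_mult \<Omega> (B_plus (\<alpha> \<triangleright>\<^bsub>\<Omega>\<^esub> \<beta>) p) q)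
     + B_plus (\<alpha> \<leftharpoonup>\<^bsub>\<Omega>\<^esub> \<beta>) (tree_mult \<Omega> p (B_plus (\<alpha> \<triangleleft>\<^bsub>\<Omega>\<^esub> \<beta>) q))
     + scale (weight \<Omega> \<alpha> \<beta>) (B_plus (\<alpha> \<bullet>\<^bsub>\<Omega>\<^esub> \<beta>) (tree_mult \<Omega> p q))"
  by (rule free_bilinear_eqI[of "\<lambda>p q. tree_mult \<Omega> (B_plus \<alpha> p) (B_plus \<beta> q)"
        "\<lambda>p q. B_plus (\<alpha> \<rightharpoonup>\<^bsub>\<Omega>\<^esub> \<beta>) (tree_mult \<Omega> (B_plus (\<alpha> \<triangleright>\<^bsub>\<Omega>\<^esub> \<beta>) p) q)
          + B_plus (\<alpha> \<leftharpoonup>\<^bsub>\<Omega>\<^esub> \<beta>) (tree_mult \<Omega> p (B_plus (\<alpha> \<triangleleft>\<^bsub>\<Omega>\<^esub> \<beta>) q))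
          + scale (weight \<Omega> \<alpha> \<beta>) (B_plus (\<alpha> \<bullet>\<^bsub>\<Omega>\<^esub> \<beta>) (tree_mult \<Omega> p q))"])
    (simp_all add: free_linear_def B_plus_linear tree_mult_linear scale_add_right ac_simps
      B_plus_vec[unfolded tree_vec_def] tree_mult_vec[unfolded tree_vec_def] diamond_graft)

section \<open>Concatenation at an angle, extended bilinearly\<close>

definition cat_vec ::
  "(('x, 'w) tree \<Rightarrow>\<^sub>0 'k::comm_ring_1) \<Rightarrow> 'x \<Rightarrow> (('x, 'w) tree \<Rightarrow>\<^sub>0 'k) \<Rightarrow> (('x, 'w) tree \<Rightarrow>\<^sub>0 'k)"
  where "cat_vec p x q = lin_ext (\<lambda>U. lin_ext (\<lambda>V. tree_vec (tree_cat U x V)) q) p"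

lemma free_linear_cat_vec:
  "free_linear (\<lambda>p. cat_vec p x q)" "free_linear (cat_vec p x)"
  unfolding cat_vec_def by (auto intro: free_linear_lin_ext_param)

lemma cat_vec_vec: "cat_vec (tree_vec U) x (tree_vec V) = tree_vec (tree_cat U x V)"
  by (simp add: cat_vec_def tree_vec_def lin_ext_single)

lemma cat_vec_linear:
  "cat_vec (p + p') x q = cat_vec p x q + cat_vec p' x q"
  "cat_vec (scale c p) x q = scale c (cat_vec p x q)"
  "cat_vec p x (q + q') = cat_vec p x q + cat_vec p x q'"
  "cat_vec p x (scale c q) = scale c (cat_vec p x q)"
  using free_linear_cat_vec(1)[of x q] free_linear_cat_vec(2)[of p x]
  by (auto simp: free_linear_def)

text \<open>Linearity in each argument reduces the identity to trees, where it is
  \<open>diamond_cat_left\<close>. Reading \<open>cat_vec p x q\<close> as the product of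
  \<open>p\<close>, \<open>x\<close> and \<open>q\<close>, this and its mirror image are instances
  of associativity that hold for every choice of operations and weight.\<close>

lemma tree_mult_cat_left: "tree_mult \<Omega> (cat_vec p x q) r = cat_vec p x (tree_mult \<Omega> q r)"
proof -
  have basis: "tree_mult \<Omega> (cat_vec (tree_vec T) x (tree_vec U)) (tree_vec V)
      = cat_vec (tree_vec T) x (tree_mult \<Omega> (tree_vec U) (tree_vec V))" for T U V
    by (simp add: cat_vec_vec tree_mult_vec diamond_cat_left)
      (simp add: cat_vec_def tree_vec_def lin_ext_single)
  have "tree_mult \<Omega> (cat_vec (tree_vec T) x q) r = cat_vec (tree_vec T) x (tree_mult \<Omega> q r)" for T
    by (rule free_bilinear_eqI[of "\<lambda>q r. tree_mult \<Omega> (cat_vec (tree_vec T) x q) r"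
          "\<lambda>q r. cat_vec (tree_vec T) x (tree_mult \<Omega> q r)"])
      (simp_all add: free_linear_def cat_vec_linear tree_mult_linear
        basis[unfolded tree_vec_def] tree_vec_def)
  then show ?thesis
    by (intro free_linear_eqI[of "\<lambda>p. tree_mult \<Omega> (cat_vec p x q) r"
          "\<lambda>p. cat_vec p x (tree_mult \<Omega> q r)" p UNIV])
      (simp_all add: free_linear_def cat_vec_linear tree_mult_linear tree_vec_def)
qed

lemma tree_mult_cat_right: "tree_mult \<Omega> p (cat_vec q x r) = cat_vec (tree_mult \<Omega> p q) x r"
proof -
  have basis: "tree_mult \<Omega> (tree_vec T) (cat_vec (tree_vec U) x (tree_vec V))
      = cat_vec (tree_mult \<Omega> (tree_vec T) (tree_vec U)) x (tree_vec V)" for T U V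
    by (simp add: cat_vec_vec tree_mult_vec diamond_cat_right)
      (simp add: cat_vec_def tree_vec_def lin_ext_single)
  have "tree_mult \<Omega> p (cat_vec q x (tree_vec V)) = cat_vec (tree_mult \<Omega> p q) x (tree_vec V)" for V
    by (rule free_bilinear_eqI[of "\<lambda>p q. tree_mult \<Omega> p (cat_vec q x (tree_vec V))"
          "\<lambda>p q. cat_vec (tree_mult \<Omega> p q) x (tree_vec V)"])
      (simp_all add: free_linear_def cat_vec_linear tree_mult_linear
        basis[unfolded tree_vec_def] tree_vec_def)
  then show ?thesis
    by (intro free_linear_eqI[of "\<lambda>r. tree_mult \<Omega> p (cat_vec q x r)"
          "\<lambda>r. cat_vec (tree_mult \<Omega> p q) x r" r UNIV])
      (simp_all add: free_linear_def cat_vec_linear tree_mult_linear tree_vec_def)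
qed

section \<open>Stability of the admissible decorations\<close>

context omega_set
begin

lemma keys_B_plus:
  assumes "\<omega> \<in> carrier \<Omega>" "Poly_Mapping.keys p \<subseteq> trees (carrier \<Omega>) Gen"
  shows "Poly_Mapping.keys (B_plus \<omega> p) \<subseteq> trees (carrier \<Omega>) Gen"
  unfolding B_plus_def using assms(2) by (rule keys_lin_ext) (use assms(1) in simp)

lemma keys_diamond:
  assumes "T \<in> trees (carrier \<Omega>) Gen" "T' \<in> trees (carrier \<Omega>) Gen"
  shows "Poly_Mapping.keys (diamond \<Omega> T T') \<subseteq> trees (carrier \<Omega>) Gen"
  using assms
proof (induction "size T + size T'" arbitrary: T T' rule: less_induct)
  case less
  show ?case
  proof (cases T rule: tree_cases)
    case unit
    then show ?thesis using less.prems by simp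
  next
    case (cat U x V)
    then have "Poly_Mapping.keys (diamond \<Omega> V T') \<subseteq> trees (carrier \<Omega>) Gen"
      using less.prems by (intro less.hyps) auto
    then show ?thesis
      unfolding cat diamond_cat_left by (rule keys_lin_ext) (use cat less.prems in simp)
  next
    case T: (graft \<alpha> S)
    show ?thesis
    proof (cases T' rule: tree_cases)
      case unit
      then show ?thesis using less.prems by simp
    next
      case (cat U x V)
      then have "Poly_Mapping.keys (diamond \<Omega> T U) \<subseteq> trees (carrier \<Omega>) Gen"
        using less.prems by (intro less.hyps) auto
      then show ?thesis
        unfolding cat diamond_cat_right by (rule keys_lin_ext) (use cat less.prems in simp)
    next
      case T': (graft \<beta> S')
      have "\<alpha> \<in> carrier \<Omega>" "\<beta> \<in> carrier \<Omega>"
        "S \<in> trees (carrier \<Omega>) Gen" "S' \<in> trees (carrier \<Omega>) Gen"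
        using less.prems T T' by auto
      then show ?thesis
        unfolding T T' diamond_graft
        by (intro order_trans[OF keys_add] Un_least order_trans[OF keys_scale] keys_B_plus less.hyps)
          (simp_all add: lft_closed rgt_closed ltri_closed rtri_closed dot_closed T T')
    qed
  qed
qed

lemma keys_tree_mult:
  assumes "Poly_Mapping.keys p \<subseteq> trees (carrier \<Omega>) Gen" "Poly_Mapping.keys q \<subseteq> trees (carrier \<Omega>) Gen"
  shows "Poly_Mapping.keys (tree_mult \<Omega> p q) \<subseteq> trees (carrier \<Omega>) Gen"
  unfolding tree_mult_def
  by (rule keys_lin_ext[OF assms(1)], rule keys_lin_ext[OF assms(2)], rule keys_diamond)

end


section \<open>Associativity of the product\<close>

context lambda_ETS
begin

abbreviation prod (infixl \<open>\<star>\<close> 70)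
  where "p \<star> q \<equiv> tree_mult \<Omega> p q"

text \<open>The assumptions on products are the induction hypothesis, and their names record which
  factors still carry a graft: \<open>a_c\<close> the outer two, \<open>none\<close> none of them.
  The labels in them are universally quantified because expanding a product relabels its grafts. Of
  the eleven terms on each side, five have coefficient 1 and six carry a weight.\<close>

lemma B_plus_assoc:
  fixes a b c :: "('x, 'a) tree \<Rightarrow>\<^sub>0 'b"
  assumes abc: "\<alpha> \<in> carrier \<Omega>" "\<beta> \<in> carrier \<Omega>" "\<gamma> \<in> carrier \<Omega>"
    and a_c: "\<And>\<delta> \<epsilon>. \<lbrakk>\<delta> \<in> carrier \<Omega>; \<epsilon> \<in> carrier \<Omega>\<rbrakk> \<Longrightarrow>
      (B_plus \<delta> a \<star> b) \<star> B_plus \<epsilon> c = B_plus \<delta> a \<star> (b \<star> B_plus \<epsilon> c)"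
    and ab_: "\<And>\<delta> \<epsilon>. \<lbrakk>\<delta> \<in> carrier \<Omega>; \<epsilon> \<in> carrier \<Omega>\<rbrakk> \<Longrightarrow>
      (B_plus \<delta> a \<star> B_plus \<epsilon> b) \<star> c = B_plus \<delta> a \<star> (B_plus \<epsilon> b \<star> c)"
    and bc_: "\<And>\<delta> \<epsilon>. \<lbrakk>\<delta> \<in> carrier \<Omega>; \<epsilon> \<in> carrier \<Omega>\<rbrakk> \<Longrightarrow>
      (a \<star> B_plus \<delta> b) \<star> B_plus \<epsilon> c = a \<star> (B_plus \<delta> b \<star> B_plus \<epsilon> c)"
    and a_: "\<And>\<delta>. \<delta> \<in> carrier \<Omega> \<Longrightarrow> (B_plus \<delta> a \<star> b) \<star> c = B_plus \<delta> a \<star> (b \<star> c)"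
    and b_: "\<And>\<delta>. \<delta> \<in> carrier \<Omega> \<Longrightarrow> (a \<star> B_plus \<delta> b) \<star> c = a \<star> (B_plus \<delta> b \<star> c)"
    and c_: "\<And>\<delta>. \<delta> \<in> carrier \<Omega> \<Longrightarrow> (a \<star> b) \<star> B_plus \<delta> c = a \<star> (b \<star> B_plus \<delta> c)"
    and none: "(a \<star> b) \<star> c = a \<star> (b \<star> c)"
  shows "(B_plus \<alpha> a \<star> B_plus \<beta> b) \<star> B_plus \<gamma> c = B_plus \<alpha> a \<star> (B_plus \<beta> b \<star> B_plus \<gamma> c)"
proof -
  note closed = abc lft_closed rgt_closed ltri_closed rtri_closed dot_closed
  let ?P = B_plus and ?w = "weight \<Omega>"
  \<comment> \<open>These label the two inner products that are expanded a second time; naming them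
    confines that expansion to the intended product.\<close>
  define u v x y where "u = \<alpha> \<triangleleft> \<beta>" "v = (\<alpha> \<leftharpoonup> \<beta>) \<triangleleft> \<gamma>"
    and "x = \<alpha> \<triangleright> (\<beta> \<rightharpoonup> \<gamma>)" "y = \<beta> \<triangleright> \<gamma>"
  note uvxy = this
  have uvxy_closed: "u \<in> carrier \<Omega>" "v \<in> carrier \<Omega>" "x \<in> carrier \<Omega>" "y \<in> carrier \<Omega>"
    by (simp_all add: uvxy closed)
  have l1: "?P (\<alpha> \<rightharpoonup> \<beta>) (?P (\<alpha> \<triangleright> \<beta>) a \<star> b) \<star> ?P \<gamma> c
      = ?P ((\<alpha> \<rightharpoonup> \<beta>) \<rightharpoonup> \<gamma>) (?P ((\<alpha> \<rightharpoonup> \<beta>) \<triangleright> \<gamma>) (?P (\<alpha> \<triangleright> \<beta>) a \<star> b) \<star> c)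
      + ?P ((\<alpha> \<rightharpoonup> \<beta>) \<leftharpoonup> \<gamma>) (?P (\<alpha> \<triangleright> \<beta>) a \<star> (b \<star> ?P ((\<alpha> \<rightharpoonup> \<beta>) \<triangleleft> \<gamma>) c))
      + scale (?w (\<alpha> \<rightharpoonup> \<beta>) \<gamma>) (?P ((\<alpha> \<rightharpoonup> \<beta>) \<bullet> \<gamma>) (?P (\<alpha> \<triangleright> \<beta>) a \<star> (b \<star> c)))"
    by (subst tree_mult_B_plus) (simp add: closed a_c a_)
  \<comment> \<open>After reassociation the inner factor is again a product of two grafts, now
    labelled \<open>u\<close> and \<open>v\<close>, and is expanded once more; hence five terms
    instead of three. \<open>r1\<close> is the mirror case, with \<open>x\<close> and
    \<open>y\<close>.\<close>
  have l2: "?P (\<alpha> \<leftharpoonup> \<beta>) (a \<star> ?P (\<alpha> \<triangleleft> \<beta>) b) \<star> ?P \<gamma> c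
      = ?P ((\<alpha> \<leftharpoonup> \<beta>) \<rightharpoonup> \<gamma>) (?P ((\<alpha> \<leftharpoonup> \<beta>) \<triangleright> \<gamma>) (a \<star> ?P (\<alpha> \<triangleleft> \<beta>) b) \<star> c)
      + (?P ((\<alpha> \<leftharpoonup> \<beta>) \<leftharpoonup> \<gamma>) (a \<star> ?P (u \<rightharpoonup> v) (?P (u \<triangleright> v) b \<star> c))
        + ?P ((\<alpha> \<leftharpoonup> \<beta>) \<leftharpoonup> \<gamma>) (a \<star> ?P (u \<leftharpoonup> v) (b \<star> ?P (u \<triangleleft> v) c))
        + scale (?w u v) (?P ((\<alpha> \<leftharpoonup> \<beta>) \<leftharpoonup> \<gamma>) (a \<star> ?P (u \<bullet> v) (b \<star> c))))
      + scale (?w (\<alpha> \<leftharpoonup> \<beta>) \<gamma>) (?P ((\<alpha> \<leftharpoonup> \<beta>) \<bullet> \<gamma>) (a \<star> (?P (\<alpha> \<triangleleft> \<beta>) b \<star> c)))"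
    by (subst tree_mult_B_plus)
      (simp add: closed uvxy_closed bc_ b_ flip: uvxy,
        simp add: tree_mult_B_plus[of _ u _ v] B_plus_linear tree_mult_linear)
  have l3: "?P (\<alpha> \<bullet> \<beta>) (a \<star> b) \<star> ?P \<gamma> c
      = ?P ((\<alpha> \<bullet> \<beta>) \<rightharpoonup> \<gamma>) (?P ((\<alpha> \<bullet> \<beta>) \<triangleright> \<gamma>) (a \<star> b) \<star> c)
      + ?P ((\<alpha> \<bullet> \<beta>) \<leftharpoonup> \<gamma>) (a \<star> (b \<star> ?P ((\<alpha> \<bullet> \<beta>) \<triangleleft> \<gamma>) c))
      + scale (?w (\<alpha> \<bullet> \<beta>) \<gamma>) (?P ((\<alpha> \<bullet> \<beta>) \<bullet> \<gamma>) (a \<star> (b \<star> c)))"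
    by (subst tree_mult_B_plus) (simp add: closed c_ none)
  have r1: "?P \<alpha> a \<star> ?P (\<beta> \<rightharpoonup> \<gamma>) (?P (\<beta> \<triangleright> \<gamma>) b \<star> c)
      = (?P (\<alpha> \<rightharpoonup> (\<beta> \<rightharpoonup> \<gamma>)) (?P (x \<rightharpoonup> y) (?P (x \<triangleright> y) a \<star> b) \<star> c)
        + ?P (\<alpha> \<rightharpoonup> (\<beta> \<rightharpoonup> \<gamma>)) (?P (x \<leftharpoonup> y) (a \<star> ?P (x \<triangleleft> y) b) \<star> c)
        + scale (?w x y) (?P (\<alpha> \<rightharpoonup> (\<beta> \<rightharpoonup> \<gamma>)) (?P (x \<bullet> y) (a \<star> b) \<star> c)))
      + ?P (\<alpha> \<leftharpoonup> (\<beta> \<rightharpoonup> \<gamma>)) (a \<star> ?P (\<alpha> \<triangleleft> (\<beta> \<rightharpoonup> \<gamma>)) (?P (\<beta> \<triangleright> \<gamma>) b \<star> c))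
      + scale (?w \<alpha> (\<beta> \<rightharpoonup> \<gamma>)) (?P (\<alpha> \<bullet> (\<beta> \<rightharpoonup> \<gamma>)) (a \<star> (?P (\<beta> \<triangleright> \<gamma>) b \<star> c)))"
    by (subst tree_mult_B_plus)
      (simp add: closed uvxy_closed flip: ab_ uvxy,
        simp add: tree_mult_B_plus[of _ x _ y] B_plus_linear tree_mult_linear)
  have r2: "?P \<alpha> a \<star> ?P (\<beta> \<leftharpoonup> \<gamma>) (b \<star> ?P (\<beta> \<triangleleft> \<gamma>) c)
      = ?P (\<alpha> \<rightharpoonup> (\<beta> \<leftharpoonup> \<gamma>)) (?P (\<alpha> \<triangleright> (\<beta> \<leftharpoonup> \<gamma>)) a \<star> (b \<star> ?P (\<beta> \<triangleleft> \<gamma>) c))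
      + ?P (\<alpha> \<leftharpoonup> (\<beta> \<leftharpoonup> \<gamma>)) (a \<star> ?P (\<alpha> \<triangleleft> (\<beta> \<leftharpoonup> \<gamma>)) (b \<star> ?P (\<beta> \<triangleleft> \<gamma>) c))
      + scale (?w \<alpha> (\<beta> \<leftharpoonup> \<gamma>)) (?P (\<alpha> \<bullet> (\<beta> \<leftharpoonup> \<gamma>)) (a \<star> (b \<star> ?P (\<beta> \<triangleleft> \<gamma>) c)))"
    by (rule tree_mult_B_plus)
  have r3: "?P \<alpha> a \<star> ?P (\<beta> \<bullet> \<gamma>) (b \<star> c)
      = ?P (\<alpha> \<rightharpoonup> (\<beta> \<bullet> \<gamma>)) (?P (\<alpha> \<triangleright> (\<beta> \<bullet> \<gamma>)) a \<star> (b \<star> c))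
      + ?P (\<alpha> \<leftharpoonup> (\<beta> \<bullet> \<gamma>)) (a \<star> ?P (\<alpha> \<triangleleft> (\<beta> \<bullet> \<gamma>)) (b \<star> c))
      + scale (?w \<alpha> (\<beta> \<bullet> \<gamma>)) (?P (\<alpha> \<bullet> (\<beta> \<bullet> \<gamma>)) (a \<star> (b \<star> c)))"
    by (rule tree_mult_B_plus)
  \<comment> \<open>In \<open>w1\<close> to \<open>w6\<close> the case split follows the conditional
    axioms: if the weight vanishes, both sides are zero; otherwise the axiom makes the labels
    equal.\<close>
  have w1: "scale (?w (\<alpha> \<rightharpoonup> \<beta>) \<gamma>) (?P ((\<alpha> \<rightharpoonup> \<beta>) \<bullet> \<gamma>) (?P (\<alpha> \<triangleright> \<beta>) a \<star> (b \<star> c)))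
      = scale (?w \<beta> \<gamma>) (?P (\<alpha> \<rightharpoonup> (\<beta> \<bullet> \<gamma>)) (?P (\<alpha> \<triangleright> (\<beta> \<bullet> \<gamma>)) a \<star> (b \<star> c)))"
    using ets1[OF abc] by (cases "?w \<beta> \<gamma> = 0") (simp_all add: weight1 abc)
  have w2: "scale (?w u v) (?P ((\<alpha> \<leftharpoonup> \<beta>) \<leftharpoonup> \<gamma>) (a \<star> ?P (u \<bullet> v) (b \<star> c)))
      = scale (?w \<beta> \<gamma>) (?P (\<alpha> \<leftharpoonup> (\<beta> \<bullet> \<gamma>)) (a \<star> ?P (\<alpha> \<triangleleft> (\<beta> \<bullet> \<gamma>)) (b \<star> c)))"
    using ets2[OF abc] by (cases "?w \<beta> \<gamma> = 0") (simp_all add: weight2 abc uvxy)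
  have w3: "scale (?w x y) (?P (\<alpha> \<rightharpoonup> (\<beta> \<rightharpoonup> \<gamma>)) (?P (x \<bullet> y) (a \<star> b) \<star> c))
      = scale (?w \<alpha> \<beta>) (?P ((\<alpha> \<bullet> \<beta>) \<rightharpoonup> \<gamma>) (?P ((\<alpha> \<bullet> \<beta>) \<triangleright> \<gamma>) (a \<star> b) \<star> c))"
    using ets3[OF abc] by (cases "?w \<alpha> \<beta> = 0") (simp_all add: weight4 abc uvxy)
  have w4: "scale (?w (\<alpha> \<leftharpoonup> \<beta>) \<gamma>) (?P ((\<alpha> \<leftharpoonup> \<beta>) \<bullet> \<gamma>) (a \<star> (?P (\<alpha> \<triangleleft> \<beta>) b \<star> c)))
      = scale (?w \<alpha> (\<beta> \<rightharpoonup> \<gamma>)) (?P (\<alpha> \<bullet> (\<beta> \<rightharpoonup> \<gamma>)) (a \<star> (?P (\<beta> \<triangleright> \<gamma>) b \<star> c)))"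
    using ets4[OF abc] weight3[OF abc] by (cases "?w (\<alpha> \<leftharpoonup> \<beta>) \<gamma> = 0") simp_all
  have w5: "scale (?w \<alpha> \<beta>) (?P ((\<alpha> \<bullet> \<beta>) \<leftharpoonup> \<gamma>) (a \<star> (b \<star> ?P ((\<alpha> \<bullet> \<beta>) \<triangleleft> \<gamma>) c)))
      = scale (?w \<alpha> (\<beta> \<leftharpoonup> \<gamma>)) (?P (\<alpha> \<bullet> (\<beta> \<leftharpoonup> \<gamma>)) (a \<star> (b \<star> ?P (\<beta> \<triangleleft> \<gamma>) c)))"
    using ets5[OF abc] weight5[OF abc] by (cases "?w \<alpha> \<beta> = 0") simp_all
  have w6: "scale (?w \<alpha> \<beta> * ?w (\<alpha> \<bullet> \<beta>) \<gamma>) (?P ((\<alpha> \<bullet> \<beta>) \<bullet> \<gamma>) (a \<star> (b \<star> c)))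
      = scale (?w \<beta> \<gamma> * ?w \<alpha> (\<beta> \<bullet> \<gamma>)) (?P (\<alpha> \<bullet> (\<beta> \<bullet> \<gamma>)) (a \<star> (b \<star> c)))"
    using ets6[OF abc] weight6[OF abc]
    by (cases "?w \<alpha> \<beta> * ?w (\<alpha> \<bullet> \<beta>) \<gamma> = 0") simp_all
  have labels: "(\<alpha> \<rightharpoonup> \<beta>) \<rightharpoonup> \<gamma> = \<alpha> \<rightharpoonup> (\<beta> \<rightharpoonup> \<gamma>)" "(\<alpha> \<leftharpoonup> \<beta>) \<rightharpoonup> \<gamma> = \<alpha> \<rightharpoonup> (\<beta> \<rightharpoonup> \<gamma>)"
    "\<alpha> \<leftharpoonup> (\<beta> \<rightharpoonup> \<gamma>) = (\<alpha> \<leftharpoonup> \<beta>) \<leftharpoonup> \<gamma>" "\<alpha> \<leftharpoonup> (\<beta> \<leftharpoonup> \<gamma>) = (\<alpha> \<leftharpoonup> \<beta>) \<leftharpoonup> \<gamma>"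
    "(\<alpha> \<rightharpoonup> \<beta>) \<leftharpoonup> \<gamma> = \<alpha> \<rightharpoonup> (\<beta> \<leftharpoonup> \<gamma>)" "\<alpha> \<triangleright> (\<beta> \<leftharpoonup> \<gamma>) = \<alpha> \<triangleright> \<beta>" "(\<alpha> \<rightharpoonup> \<beta>) \<triangleleft> \<gamma> = \<beta> \<triangleleft> \<gamma>"
    "u \<leftharpoonup> v = \<alpha> \<triangleleft> (\<beta> \<leftharpoonup> \<gamma>)" "u \<triangleleft> v = \<beta> \<triangleleft> \<gamma>" "u \<rightharpoonup> v = \<alpha> \<triangleleft> (\<beta> \<rightharpoonup> \<gamma>)" "u \<triangleright> v = \<beta> \<triangleright> \<gamma>"
    "x \<leftharpoonup> y = (\<alpha> \<leftharpoonup> \<beta>) \<triangleright> \<gamma>" "x \<triangleleft> y = \<alpha> \<triangleleft> \<beta>" "x \<rightharpoonup> y = (\<alpha> \<rightharpoonup> \<beta>) \<triangleright> \<gamma>" "x \<triangleright> y = \<alpha> \<triangleright> \<beta>"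
    using dias1[OF abc] dias2[OF abc] dias3[OF abc] eds1[OF abc] eds2[OF abc] eds3[OF abc]
      eds4[OF abc] eds5[OF abc] eds6[OF abc] eds7[OF abc] eds8[OF abc] eds9[OF abc] eds10[OF abc]
    by (auto simp: uvxy)
  show ?thesis
    unfolding tree_mult_B_plus[of \<Omega> \<alpha> a \<beta> b] tree_mult_B_plus[of \<Omega> \<beta> b \<gamma> c] tree_mult_linear
      l1 l2 l3 r1 r2 r3 scale_add_right scale_scale w1 w2 w3 w4 w5 w6 labels
    by (simp add: ac_simps)
qed

lemma tree_vec_assoc:
  assumes "T1 \<in> trees (carrier \<Omega>) Gen" "T2 \<in> trees (carrier \<Omega>) Gen" "T3 \<in> trees (carrier \<Omega>) Gen"
  shows "(tree_vec T1 \<star> tree_vec T2) \<star> tree_vec T3 = tree_vec T1 \<star> (tree_vec T2 \<star> tree_vec T3)"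
  using assms
proof (induction "size T1 + size T2 + size T3" arbitrary: T1 T2 T3 rule: less_induct)
  case less
  note cat_simps = cat_vec_vec[symmetric] tree_mult_cat_left tree_mult_cat_right
  show ?case
  proof (cases T2 rule: tree_cases)
    case T2: (graft \<beta> b)
    show ?thesis
    proof (cases T1 rule: tree_cases)
      case T1: (graft \<alpha> a)
      show ?thesis
      proof (cases T3 rule: tree_cases)
        case T3: (graft \<gamma> c)
        have labels: "\<alpha> \<in> carrier \<Omega>" "\<beta> \<in> carrier \<Omega>" "\<gamma> \<in> carrier \<Omega>"
          and trees: "a \<in> trees (carrier \<Omega>) Gen" "b \<in> trees (carrier \<Omega>) Gen"
            "c \<in> trees (carrier \<Omega>) Gen"
          using less.prems T1 T2 T3 by auto
        show ?thesis
          \<comment> \<open>Each product assumption of \<open>B_plus_assoc\<close> concerns the same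
            three subtrees with at least one graft removed, so the total size has dropped by at
            least two, whatever the labels.\<close>
          unfolding T1 T2 T3 B_plus_vec[symmetric]
          by (rule B_plus_assoc[OF labels]; (unfold B_plus_vec)?; rule less.hyps)
            (simp_all add: T1 T2 T3 trees)
      next
        case (cat U x V)
        then show ?thesis
          using less.hyps[of T1 T2 U] less.prems by (simp add: cat_simps)
      qed simp
    next
      case (cat U x V)
      then show ?thesis
        using less.hyps[of V T2 T3] less.prems by (simp add: cat_simps)
    qed simp
  \<comment> \<open>A middle factor that is the unit or is cut at an angle needs no induction
    hypothesis: in the latter case the two multiplications act on opposite sides of the cut.\<close>
  qed (simp_all add: cat_simps)
qed

lemma tree_mult_assoc:
  assumes "Poly_Mapping.keys p \<subseteq> trees (carrier \<Omega>) Gen"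
    and "Poly_Mapping.keys q \<subseteq> trees (carrier \<Omega>) Gen"
    and "Poly_Mapping.keys r \<subseteq> trees (carrier \<Omega>) Gen"
  shows "(p \<star> q) \<star> r = p \<star> (q \<star> r)"
  using assms(1)
proof (rule free_linear_eqI[of "\<lambda>p. (p \<star> q) \<star> r" "\<lambda>p. p \<star> (q \<star> r)", rotated 2])
  fix T1 assume T1: "T1 \<in> trees (carrier \<Omega>) Gen"
  show "(Poly_Mapping.single T1 1 \<star> q) \<star> r = Poly_Mapping.single T1 1 \<star> (q \<star> r)"
    using assms(2)
  proof (rule free_linear_eqI[of "\<lambda>q. (Poly_Mapping.single T1 1 \<star> q) \<star> r"
        "\<lambda>q. Poly_Mapping.single T1 1 \<star> (q \<star> r)", rotated 2])
    fix T2 assume T2: "T2 \<in> trees (carrier \<Omega>) Gen"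
    show "(Poly_Mapping.single T1 1 \<star> Poly_Mapping.single T2 1) \<star> r
        = Poly_Mapping.single T1 1 \<star> (Poly_Mapping.single T2 1 \<star> r)"
      using assms(3)
      by (rule free_linear_eqI[of "\<lambda>r. (Poly_Mapping.single T1 1 \<star> Poly_Mapping.single T2 1) \<star> r"
            "\<lambda>r. Poly_Mapping.single T1 1 \<star> (Poly_Mapping.single T2 1 \<star> r)", rotated 2])
        (simp_all add: tree_vec_assoc[OF T1 T2, unfolded tree_vec_def] free_linear_def tree_mult_linear)
  qed (simp_all add: free_linear_def tree_mult_linear)
qed (simp_all add: free_linear_def tree_mult_linear)

end

text \<open>The angle inside \<open>g\<close> keeps the shapes apart: with the one-vertex tree in
  its place, the terms made of three successively nested grafts would all have the same shape. Two
  multiples \<open>scale c (tree_vec T)\<close> and \<open>scale d (tree_vec T')\<close> agree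
  exactly if \<open>c = d\<close> and, unless \<open>c = 0\<close>, also \<open>T = T'\<close>; this
  is the origin of the conditional form of the weighted axioms.\<close>

lemma (in omega_set) lambda_ETS_if_assoc:
  fixes x :: 'x
  defines "g \<equiv> Node Leaf [(x, Leaf)]"
  assumes assoc: "\<And>\<alpha> \<beta> \<gamma>. \<lbrakk>\<alpha> \<in> carrier \<Omega>; \<beta> \<in> carrier \<Omega>; \<gamma> \<in> carrier \<Omega>\<rbrakk> \<Longrightarrow>
      tree_mult \<Omega> (tree_mult \<Omega> (tree_vec (graft \<alpha> g)) (tree_vec (graft \<beta> g))) (tree_vec (graft \<gamma> g))
      = tree_mult \<Omega> (tree_vec (graft \<alpha> g)) (tree_mult \<Omega> (tree_vec (graft \<beta> g)) (tree_vec (graft \<gamma> g)))"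
  shows "lambda_ETS \<Omega>"
proof -
  let ?w = "weight \<Omega>"
  have g: "g = tree_cat tree_unit x tree_unit" by (simp add: g_def)
  \<comment> \<open>One conjunct for each shape: the first five belong to terms with coefficient 1
    on both sides, the last six to weighted terms.\<close>
  have rel: "((\<alpha> \<rightharpoonup> \<beta>) \<rightharpoonup> \<gamma> = \<alpha> \<rightharpoonup> (\<beta> \<rightharpoonup> \<gamma>)
        \<and> (\<alpha> \<rightharpoonup> \<beta>) \<triangleright> \<gamma> = (\<alpha> \<triangleright> (\<beta> \<rightharpoonup> \<gamma>)) \<rightharpoonup> (\<beta> \<triangleright> \<gamma>)
        \<and> \<alpha> \<triangleright> \<beta> = (\<alpha> \<triangleright> (\<beta> \<rightharpoonup> \<gamma>)) \<triangleright> (\<beta> \<triangleright> \<gamma>))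
    \<and> ((\<alpha> \<leftharpoonup> \<beta>) \<rightharpoonup> \<gamma> = \<alpha> \<rightharpoonup> (\<beta> \<rightharpoonup> \<gamma>)
        \<and> (\<alpha> \<leftharpoonup> \<beta>) \<triangleright> \<gamma> = (\<alpha> \<triangleright> (\<beta> \<rightharpoonup> \<gamma>)) \<leftharpoonup> (\<beta> \<triangleright> \<gamma>)
        \<and> \<alpha> \<triangleleft> \<beta> = (\<alpha> \<triangleright> (\<beta> \<rightharpoonup> \<gamma>)) \<triangleleft> (\<beta> \<triangleright> \<gamma>))
    \<and> ((\<alpha> \<rightharpoonup> \<beta>) \<leftharpoonup> \<gamma> = \<alpha> \<rightharpoonup> (\<beta> \<leftharpoonup> \<gamma>)
        \<and> \<alpha> \<triangleright> \<beta> = \<alpha> \<triangleright> (\<beta> \<leftharpoonup> \<gamma>) \<and> (\<alpha> \<rightharpoonup> \<beta>) \<triangleleft> \<gamma> = \<beta> \<triangleleft> \<gamma>)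
    \<and> ((\<alpha> \<leftharpoonup> \<beta>) \<leftharpoonup> \<gamma> = \<alpha> \<leftharpoonup> (\<beta> \<rightharpoonup> \<gamma>)
        \<and> (\<alpha> \<triangleleft> \<beta>) \<rightharpoonup> ((\<alpha> \<leftharpoonup> \<beta>) \<triangleleft> \<gamma>) = \<alpha> \<triangleleft> (\<beta> \<rightharpoonup> \<gamma>)
        \<and> (\<alpha> \<triangleleft> \<beta>) \<triangleright> ((\<alpha> \<leftharpoonup> \<beta>) \<triangleleft> \<gamma>) = \<beta> \<triangleright> \<gamma>)
    \<and> ((\<alpha> \<leftharpoonup> \<beta>) \<leftharpoonup> \<gamma> = \<alpha> \<leftharpoonup> (\<beta> \<leftharpoonup> \<gamma>)
        \<and> (\<alpha> \<triangleleft> \<beta>) \<leftharpoonup> ((\<alpha> \<leftharpoonup> \<beta>) \<triangleleft> \<gamma>) = \<alpha> \<triangleleft> (\<beta> \<leftharpoonup> \<gamma>)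
        \<and> (\<alpha> \<triangleleft> \<beta>) \<triangleleft> ((\<alpha> \<leftharpoonup> \<beta>) \<triangleleft> \<gamma>) = \<beta> \<triangleleft> \<gamma>)
    \<and> (?w (\<alpha> \<rightharpoonup> \<beta>) \<gamma> = ?w \<beta> \<gamma> \<and> (?w \<beta> \<gamma> \<noteq> 0 \<longrightarrow>
        \<alpha> \<triangleright> \<beta> = \<alpha> \<triangleright> (\<beta> \<bullet> \<gamma>) \<and> (\<alpha> \<rightharpoonup> \<beta>) \<bullet> \<gamma> = \<alpha> \<rightharpoonup> (\<beta> \<bullet> \<gamma>)))
    \<and> (?w (\<alpha> \<triangleleft> \<beta>) ((\<alpha> \<leftharpoonup> \<beta>) \<triangleleft> \<gamma>) = ?w \<beta> \<gamma> \<and> (?w \<beta> \<gamma> \<noteq> 0 \<longrightarrow>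
        (\<alpha> \<triangleleft> \<beta>) \<bullet> ((\<alpha> \<leftharpoonup> \<beta>) \<triangleleft> \<gamma>) = \<alpha> \<triangleleft> (\<beta> \<bullet> \<gamma>) \<and> (\<alpha> \<leftharpoonup> \<beta>) \<leftharpoonup> \<gamma> = \<alpha> \<leftharpoonup> (\<beta> \<bullet> \<gamma>)))
    \<and> (?w (\<alpha> \<leftharpoonup> \<beta>) \<gamma> = ?w \<alpha> (\<beta> \<rightharpoonup> \<gamma>) \<and> (?w (\<alpha> \<leftharpoonup> \<beta>) \<gamma> \<noteq> 0 \<longrightarrow>
        (\<alpha> \<leftharpoonup> \<beta>) \<bullet> \<gamma> = \<alpha> \<bullet> (\<beta> \<rightharpoonup> \<gamma>) \<and> \<alpha> \<triangleleft> \<beta> = \<beta> \<triangleright> \<gamma>))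
    \<and> (?w (\<alpha> \<triangleright> (\<beta> \<rightharpoonup> \<gamma>)) (\<beta> \<triangleright> \<gamma>) = ?w \<alpha> \<beta> \<and> (?w \<alpha> \<beta> \<noteq> 0 \<longrightarrow>
        \<alpha> \<rightharpoonup> (\<beta> \<rightharpoonup> \<gamma>) = (\<alpha> \<bullet> \<beta>) \<rightharpoonup> \<gamma> \<and> (\<alpha> \<triangleright> (\<beta> \<rightharpoonup> \<gamma>)) \<bullet> (\<beta> \<triangleright> \<gamma>) = (\<alpha> \<bullet> \<beta>) \<triangleright> \<gamma>))
    \<and> (?w \<alpha> \<beta> = ?w \<alpha> (\<beta> \<leftharpoonup> \<gamma>) \<and> (?w \<alpha> \<beta> \<noteq> 0 \<longrightarrow>
        (\<alpha> \<bullet> \<beta>) \<triangleleft> \<gamma> = \<beta> \<triangleleft> \<gamma> \<and> (\<alpha> \<bullet> \<beta>) \<leftharpoonup> \<gamma> = \<alpha> \<bullet> (\<beta> \<leftharpoonup> \<gamma>)))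
    \<and> (?w \<alpha> \<beta> * ?w (\<alpha> \<bullet> \<beta>) \<gamma> = ?w \<beta> \<gamma> * ?w \<alpha> (\<beta> \<bullet> \<gamma>) \<and> (?w \<alpha> \<beta> * ?w (\<alpha> \<bullet> \<beta>) \<gamma> \<noteq> 0 \<longrightarrow>
        (\<alpha> \<bullet> \<beta>) \<bullet> \<gamma> = \<alpha> \<bullet> (\<beta> \<bullet> \<gamma>)))"
    if "\<alpha> \<in> carrier \<Omega>" "\<beta> \<in> carrier \<Omega>" "\<gamma> \<in> carrier \<Omega>" for \<alpha> \<beta> \<gamma>
  proof -
    define u v r s where "u = \<alpha> \<triangleleft> \<beta>" "v = (\<alpha> \<leftharpoonup> \<beta>) \<triangleleft> \<gamma>"
      and "r = \<alpha> \<triangleright> (\<beta> \<rightharpoonup> \<gamma>)" "s = \<beta> \<triangleright> \<gamma>"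
    note uvrs = this
    let ?L = "\<lambda>\<omega> T. Node (Edge \<omega> T) [(x, Leaf)]" and ?R = "\<lambda>\<omega> T. Node Leaf [(x, Edge \<omega> T)]"
    let ?gg = "Node Leaf [(x, Leaf), (x, Leaf)]"
    let ?t = "\<lambda>\<omega> T. tree_vec (graft \<omega> T)"
    have eq: "?t ((\<alpha> \<rightharpoonup> \<beta>) \<rightharpoonup> \<gamma>) (?L ((\<alpha> \<rightharpoonup> \<beta>) \<triangleright> \<gamma>) (?L (\<alpha> \<triangleright> \<beta>) g))
        + ?t ((\<alpha> \<leftharpoonup> \<beta>) \<rightharpoonup> \<gamma>) (?L ((\<alpha> \<leftharpoonup> \<beta>) \<triangleright> \<gamma>) (?R (\<alpha> \<triangleleft> \<beta>) g))
        + ?t ((\<alpha> \<rightharpoonup> \<beta>) \<leftharpoonup> \<gamma>) (Node (Edge (\<alpha> \<triangleright> \<beta>) g) [(x, Edge ((\<alpha> \<rightharpoonup> \<beta>) \<triangleleft> \<gamma>) g)])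
        + ?t ((\<alpha> \<leftharpoonup> \<beta>) \<leftharpoonup> \<gamma>) (?R (u \<rightharpoonup> v) (?L (u \<triangleright> v) g))
        + ?t ((\<alpha> \<leftharpoonup> \<beta>) \<leftharpoonup> \<gamma>) (?R (u \<leftharpoonup> v) (?R (u \<triangleleft> v) g))
        + scale (?w (\<alpha> \<rightharpoonup> \<beta>) \<gamma>) (?t ((\<alpha> \<rightharpoonup> \<beta>) \<bullet> \<gamma>) (Node (Edge (\<alpha> \<triangleright> \<beta>) g) [(x, Leaf), (x, Leaf)]))
        + scale (?w u v) (?t ((\<alpha> \<leftharpoonup> \<beta>) \<leftharpoonup> \<gamma>) (?R (u \<bullet> v) ?gg))
        + scale (?w (\<alpha> \<leftharpoonup> \<beta>) \<gamma>) (?t ((\<alpha> \<leftharpoonup> \<beta>) \<bullet> \<gamma>) (Node Leaf [(x, Edge (\<alpha> \<triangleleft> \<beta>) g), (x, Leaf)]))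
        + scale (?w \<alpha> \<beta>) (?t ((\<alpha> \<bullet> \<beta>) \<rightharpoonup> \<gamma>) (?L ((\<alpha> \<bullet> \<beta>) \<triangleright> \<gamma>) ?gg))
        + scale (?w \<alpha> \<beta>) (?t ((\<alpha> \<bullet> \<beta>) \<leftharpoonup> \<gamma>) (Node Leaf [(x, Leaf), (x, Edge ((\<alpha> \<bullet> \<beta>) \<triangleleft> \<gamma>) g)]))
        + scale (?w \<alpha> \<beta> * ?w (\<alpha> \<bullet> \<beta>) \<gamma>) (?t ((\<alpha> \<bullet> \<beta>) \<bullet> \<gamma>) (Node Leaf [(x, Leaf), (x, Leaf), (x, Leaf)]))
      = ?t (\<alpha> \<rightharpoonup> (\<beta> \<rightharpoonup> \<gamma>)) (?L (r \<rightharpoonup> s) (?L (r \<triangleright> s) g))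
        + ?t (\<alpha> \<rightharpoonup> (\<beta> \<rightharpoonup> \<gamma>)) (?L (r \<leftharpoonup> s) (?R (r \<triangleleft> s) g))
        + ?t (\<alpha> \<rightharpoonup> (\<beta> \<leftharpoonup> \<gamma>)) (Node (Edge (\<alpha> \<triangleright> (\<beta> \<leftharpoonup> \<gamma>)) g) [(x, Edge (\<beta> \<triangleleft> \<gamma>) g)])
        + ?t (\<alpha> \<leftharpoonup> (\<beta> \<rightharpoonup> \<gamma>)) (?R (\<alpha> \<triangleleft> (\<beta> \<rightharpoonup> \<gamma>)) (?L (\<beta> \<triangleright> \<gamma>) g))
        + ?t (\<alpha> \<leftharpoonup> (\<beta> \<leftharpoonup> \<gamma>)) (?R (\<alpha> \<triangleleft> (\<beta> \<leftharpoonup> \<gamma>)) (?R (\<beta> \<triangleleft> \<gamma>) g))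
        + scale (?w \<beta> \<gamma>) (?t (\<alpha> \<rightharpoonup> (\<beta> \<bullet> \<gamma>)) (Node (Edge (\<alpha> \<triangleright> (\<beta> \<bullet> \<gamma>)) g) [(x, Leaf), (x, Leaf)]))
        + scale (?w \<beta> \<gamma>) (?t (\<alpha> \<leftharpoonup> (\<beta> \<bullet> \<gamma>)) (?R (\<alpha> \<triangleleft> (\<beta> \<bullet> \<gamma>)) ?gg))
        + scale (?w \<alpha> (\<beta> \<rightharpoonup> \<gamma>)) (?t (\<alpha> \<bullet> (\<beta> \<rightharpoonup> \<gamma>)) (Node Leaf [(x, Edge (\<beta> \<triangleright> \<gamma>) g), (x, Leaf)]))
        + scale (?w r s) (?t (\<alpha> \<rightharpoonup> (\<beta> \<rightharpoonup> \<gamma>)) (?L (r \<bullet> s) ?gg))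
        + scale (?w \<alpha> (\<beta> \<leftharpoonup> \<gamma>)) (?t (\<alpha> \<bullet> (\<beta> \<leftharpoonup> \<gamma>)) (Node Leaf [(x, Leaf), (x, Edge (\<beta> \<triangleleft> \<gamma>) g)]))
        + scale (?w \<beta> \<gamma> * ?w \<alpha> (\<beta> \<bullet> \<gamma>)) (?t (\<alpha> \<bullet> (\<beta> \<bullet> \<gamma>)) (Node Leaf [(x, Leaf), (x, Leaf), (x, Leaf)]))"
      (is "?lhs = ?rhs")
    proof -
      \<comment> \<open>All trees are brought into the form of concatenations of units and grafts,
        bracketed to the left by \<open>cat_assoc\<close>. The lemmas on the product apply to this
        form, and equal trees on the two sides become syntactically equal.\<close>
      have cats: "Node (Edge \<omega> T) [] = graft \<omega> T"
          "Node b [(y, c)] = tree_cat (Node b []) y (Node c [])"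
          "Node b [(y, c), (z, d)] = tree_cat (tree_cat (Node b []) y (Node c [])) z (Node d [])"
          "Node b [(y, c), (z, d), (y', e)]
            = tree_cat (tree_cat (tree_cat (Node b []) y (Node c [])) z (Node d [])) y' (Node e [])"
        for \<omega> T b c d e and y z y' :: 'x
        by (simp_all add: graft_def)
      have cat_assoc: "tree_cat T y (tree_cat U z V) = tree_cat (tree_cat T y U) z V"
        for T U V and y z :: 'x
        by (cases T; cases U; cases V) simp
      show ?thesis
        using assoc[OF that]
        by (simp add: g tree_mult_vec tree_mult_linear diamond_graft B_plus_vec B_plus_linear
            diamond_cat_left diamond_cat_right lin_ext_add lin_ext_scale scale_add_right cats
            cat_assoc uvrs ac_simps del: tree_cat.simps)
    qed
    have coeff: "Poly_Mapping.lookup ?lhs T = Poly_Mapping.lookup ?rhs T" for T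
      by (simp only: eq)
    note ev = lookup_add lookup_scale tree_vec_def lookup_single when_def graft_def g_def
    \<comment> \<open>In \<open>a\<close> to \<open>e\<close> the coefficient on the left is 1,
      which is nonzero, so the chosen tree must occur on the right; only the term of the same shape
      can supply it.\<close>
    have a: "(\<alpha> \<rightharpoonup> \<beta>) \<rightharpoonup> \<gamma> = \<alpha> \<rightharpoonup> (\<beta> \<rightharpoonup> \<gamma>) \<and> (\<alpha> \<rightharpoonup> \<beta>) \<triangleright> \<gamma> = r \<rightharpoonup> s \<and> \<alpha> \<triangleright> \<beta> = r \<triangleright> s"
      using coeff[of "graft ((\<alpha> \<rightharpoonup> \<beta>) \<rightharpoonup> \<gamma>) (?L ((\<alpha> \<rightharpoonup> \<beta>) \<triangleright> \<gamma>) (?L (\<alpha> \<triangleright> \<beta>) g))"]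
      by (simp add: ev split: if_splits)
    have b: "(\<alpha> \<leftharpoonup> \<beta>) \<rightharpoonup> \<gamma> = \<alpha> \<rightharpoonup> (\<beta> \<rightharpoonup> \<gamma>) \<and> (\<alpha> \<leftharpoonup> \<beta>) \<triangleright> \<gamma> = r \<leftharpoonup> s \<and> \<alpha> \<triangleleft> \<beta> = r \<triangleleft> s"
      using coeff[of "graft ((\<alpha> \<leftharpoonup> \<beta>) \<rightharpoonup> \<gamma>) (?L ((\<alpha> \<leftharpoonup> \<beta>) \<triangleright> \<gamma>) (?R (\<alpha> \<triangleleft> \<beta>) g))"]
      by (simp add: ev split: if_splits)
    have c: "(\<alpha> \<rightharpoonup> \<beta>) \<leftharpoonup> \<gamma> = \<alpha> \<rightharpoonup> (\<beta> \<leftharpoonup> \<gamma>) \<and> \<alpha> \<triangleright> \<beta> = \<alpha> \<triangleright> (\<beta> \<leftharpoonup> \<gamma>) \<and> (\<alpha> \<rightharpoonup> \<beta>) \<triangleleft> \<gamma> = \<beta> \<triangleleft> \<gamma>"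
      using coeff[of "graft ((\<alpha> \<rightharpoonup> \<beta>) \<leftharpoonup> \<gamma>) (Node (Edge (\<alpha> \<triangleright> \<beta>) g) [(x, Edge ((\<alpha> \<rightharpoonup> \<beta>) \<triangleleft> \<gamma>) g)])"]
      by (simp add: ev split: if_splits)
    have d: "(\<alpha> \<leftharpoonup> \<beta>) \<leftharpoonup> \<gamma> = \<alpha> \<leftharpoonup> (\<beta> \<rightharpoonup> \<gamma>) \<and> u \<rightharpoonup> v = \<alpha> \<triangleleft> (\<beta> \<rightharpoonup> \<gamma>) \<and> u \<triangleright> v = \<beta> \<triangleright> \<gamma>"
      using coeff[of "graft ((\<alpha> \<leftharpoonup> \<beta>) \<leftharpoonup> \<gamma>) (?R (u \<rightharpoonup> v) (?L (u \<triangleright> v) g))"]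
      by (simp add: ev split: if_splits)
    have e: "(\<alpha> \<leftharpoonup> \<beta>) \<leftharpoonup> \<gamma> = \<alpha> \<leftharpoonup> (\<beta> \<leftharpoonup> \<gamma>) \<and> u \<leftharpoonup> v = \<alpha> \<triangleleft> (\<beta> \<leftharpoonup> \<gamma>) \<and> u \<triangleleft> v = \<beta> \<triangleleft> \<gamma>"
      using coeff[of "graft ((\<alpha> \<leftharpoonup> \<beta>) \<leftharpoonup> \<gamma>) (?R (u \<leftharpoonup> v) (?R (u \<triangleleft> v) g))"]
      by (simp add: ev split: if_splits)
    \<comment> \<open>A weighted term may have coefficient zero, so from here on the coefficients at
      both the left and the right tree are compared. If the two trees differ, both weights turn out
      to be zero, so the weights agree in every case.\<close>
    have f: "?w (\<alpha> \<rightharpoonup> \<beta>) \<gamma> = ?w \<beta> \<gamma> \<and> (?w \<beta> \<gamma> \<noteq> 0 \<longrightarrow> \<alpha> \<triangleright> \<beta> = \<alpha> \<triangleright> (\<beta> \<bullet> \<gamma>) \<and> (\<alpha> \<rightharpoonup> \<beta>) \<bullet> \<gamma> = \<alpha> \<rightharpoonup> (\<beta> \<bullet> \<gamma>))"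
      using coeff[of "graft ((\<alpha> \<rightharpoonup> \<beta>) \<bullet> \<gamma>) (Node (Edge (\<alpha> \<triangleright> \<beta>) g) [(x, Leaf), (x, Leaf)])"]
        coeff[of "graft (\<alpha> \<rightharpoonup> (\<beta> \<bullet> \<gamma>)) (Node (Edge (\<alpha> \<triangleright> (\<beta> \<bullet> \<gamma>)) g) [(x, Leaf), (x, Leaf)])"]
      by (simp add: ev split: if_splits)
    have gg: "?w u v = ?w \<beta> \<gamma> \<and> (?w \<beta> \<gamma> \<noteq> 0 \<longrightarrow> u \<bullet> v = \<alpha> \<triangleleft> (\<beta> \<bullet> \<gamma>) \<and> (\<alpha> \<leftharpoonup> \<beta>) \<leftharpoonup> \<gamma> = \<alpha> \<leftharpoonup> (\<beta> \<bullet> \<gamma>))"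
      using coeff[of "graft ((\<alpha> \<leftharpoonup> \<beta>) \<leftharpoonup> \<gamma>) (?R (u \<bullet> v) ?gg)"]
        coeff[of "graft (\<alpha> \<leftharpoonup> (\<beta> \<bullet> \<gamma>)) (?R (\<alpha> \<triangleleft> (\<beta> \<bullet> \<gamma>)) ?gg)"]
      by (simp add: ev split: if_splits)
    have h: "?w (\<alpha> \<leftharpoonup> \<beta>) \<gamma> = ?w \<alpha> (\<beta> \<rightharpoonup> \<gamma>) \<and> (?w (\<alpha> \<leftharpoonup> \<beta>) \<gamma> \<noteq> 0 \<longrightarrow> (\<alpha> \<leftharpoonup> \<beta>) \<bullet> \<gamma> = \<alpha> \<bullet> (\<beta> \<rightharpoonup> \<gamma>) \<and> \<alpha> \<triangleleft> \<beta> = \<beta> \<triangleright> \<gamma>)"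
      using coeff[of "graft ((\<alpha> \<leftharpoonup> \<beta>) \<bullet> \<gamma>) (Node Leaf [(x, (Edge (\<alpha> \<triangleleft> \<beta>) g)), (x, Leaf)])"]
        coeff[of "graft (\<alpha> \<bullet> (\<beta> \<rightharpoonup> \<gamma>)) (Node Leaf [(x, (Edge (\<beta> \<triangleright> \<gamma>) g)), (x, Leaf)])"]
      by (simp add: ev split: if_splits)
    have i: "?w r s = ?w \<alpha> \<beta> \<and> (?w \<alpha> \<beta> \<noteq> 0 \<longrightarrow> \<alpha> \<rightharpoonup> (\<beta> \<rightharpoonup> \<gamma>) = (\<alpha> \<bullet> \<beta>) \<rightharpoonup> \<gamma> \<and> r \<bullet> s = (\<alpha> \<bullet> \<beta>) \<triangleright> \<gamma>)"
      using coeff[of "graft (\<alpha> \<rightharpoonup> (\<beta> \<rightharpoonup> \<gamma>)) (?L (r \<bullet> s) ?gg)"]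
        coeff[of "graft ((\<alpha> \<bullet> \<beta>) \<rightharpoonup> \<gamma>) (?L ((\<alpha> \<bullet> \<beta>) \<triangleright> \<gamma>) ?gg)"]
      by (simp add: ev split: if_splits)
    have j: "?w \<alpha> \<beta> = ?w \<alpha> (\<beta> \<leftharpoonup> \<gamma>) \<and> (?w \<alpha> \<beta> \<noteq> 0 \<longrightarrow> (\<alpha> \<bullet> \<beta>) \<triangleleft> \<gamma> = \<beta> \<triangleleft> \<gamma> \<and> (\<alpha> \<bullet> \<beta>) \<leftharpoonup> \<gamma> = \<alpha> \<bullet> (\<beta> \<leftharpoonup> \<gamma>))"
      using coeff[of "graft ((\<alpha> \<bullet> \<beta>) \<leftharpoonup> \<gamma>) (Node Leaf [(x, Leaf), (x, (Edge ((\<alpha> \<bullet> \<beta>) \<triangleleft> \<gamma>) g))])"]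
        coeff[of "graft (\<alpha> \<bullet> (\<beta> \<leftharpoonup> \<gamma>)) (Node Leaf [(x, Leaf), (x, (Edge (\<beta> \<triangleleft> \<gamma>) g))])"]
      by (simp add: ev split: if_splits)
    have k: "?w \<alpha> \<beta> * ?w (\<alpha> \<bullet> \<beta>) \<gamma> = ?w \<beta> \<gamma> * ?w \<alpha> (\<beta> \<bullet> \<gamma>) \<and> (?w \<alpha> \<beta> * ?w (\<alpha> \<bullet> \<beta>) \<gamma> \<noteq> 0 \<longrightarrow> (\<alpha> \<bullet> \<beta>) \<bullet> \<gamma> = \<alpha> \<bullet> (\<beta> \<bullet> \<gamma>))"
      using coeff[of "graft ((\<alpha> \<bullet> \<beta>) \<bullet> \<gamma>) (Node Leaf [(x, Leaf), (x, Leaf), (x, Leaf)])"]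
        coeff[of "graft (\<alpha> \<bullet> (\<beta> \<bullet> \<gamma>)) (Node Leaf [(x, Leaf), (x, Leaf), (x, Leaf)])"]
      by (simp add: ev split: if_splits)
    show ?thesis
      using a b c d e f gg h i j k unfolding uvrs by blast
  qed
  show ?thesis
    \<comment> \<open>The chained equalities of the diassociative axioms are each spread over two
      shapes: \<open>dias1\<close> over \<open>d\<close> and \<open>e\<close>, \<open>dias3\<close>
      over \<open>a\<close> and \<open>b\<close>. Every other axiom comes from a single
      shape.\<close>
    by unfold_locales (metis rel)+
qed

section \<open>The algebra of trees\<close>

lemma ring_of_type_algebra_simps [simp]:
  "carrier (ring_of_type_algebra :: 'k::comm_ring_1 ring) = UNIV"
  "\<zero>\<^bsub>ring_of_type_algebra :: 'k ring\<^esub> = 0"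
  "\<one>\<^bsub>ring_of_type_algebra :: 'k ring\<^esub> = 1"
  "a \<oplus>\<^bsub>ring_of_type_algebra :: 'k ring\<^esub> b = a + b"
  "a \<otimes>\<^bsub>ring_of_type_algebra :: 'k ring\<^esub> b = a * b"
  by (simp_all add: ring_of_type_algebra_def)

lemma tree_algebra_simps [simp]:
  "carrier (tree_algebra \<Omega> Gen) = {p. Poly_Mapping.keys p \<subseteq> trees (carrier \<Omega>) Gen}"
  "p \<otimes>\<^bsub>tree_algebra \<Omega> Gen\<^esub> q = tree_mult \<Omega> p q"
  "\<one>\<^bsub>tree_algebra \<Omega> Gen\<^esub> = tree_vec tree_unit"
  "\<zero>\<^bsub>tree_algebra \<Omega> Gen\<^esub> = 0"
  "p \<oplus>\<^bsub>tree_algebra \<Omega> Gen\<^esub> q = p + q"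
  "c \<odot>\<^bsub>tree_algebra \<Omega> Gen\<^esub> p = scale c p"
  by (simp_all add: tree_algebra_def tree_mult_def)

lemma tree_gen_eq_cat_vec:
  "tree_gen x = cat_vec (tree_vec tree_unit) x (tree_vec tree_unit)"
  by (simp add: tree_gen_def cat_vec_vec)

text \<open>Apart from closure of the labels, the axioms on \<Omega> enter only through
  \<open>tree_mult_assoc\<close>; what remains is linearity, the unit laws and
  \<open>tree_mult_B_plus\<close>.\<close>

lemma (in lambda_ETS) omega_rba_tree_algebra: "omega_rba \<Omega> (tree_algebra \<Omega> Gen) B_plus"
proof -
  let ?F = "tree_algebra \<Omega> Gen"
  note closed = subsetD[OF keys_add] subsetD[OF keys_scale]
    subsetD[OF keys_tree_mult] subsetD[OF keys_B_plus]
  have group: "abelian_group ?F"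
  proof (rule abelian_groupI)
    fix p assume "p \<in> carrier ?F"
    then show "\<exists>q\<in>carrier ?F. q \<oplus>\<^bsub>?F\<^esub> p = \<zero>\<^bsub>?F\<^esub>"
      by (intro bexI[of _ "- p"]) (auto simp: in_keys_iff)
  qed (auto simp: ac_simps dest: closed)
  show ?thesis
  proof (intro omega_rba.intro omega_set_axioms assoc_algebra.intro omega_rba_axioms.intro
      assoc_algebra_axioms.intro)
    show "module ring_of_type_algebra ?F"
      by (rule moduleI[OF cring_from_type_algebra group])
        (auto simp: scale_add_left scale_add_right dest: closed)
    have "monoid ?F"
      by (rule monoidI) (auto simp: tree_mult_assoc dest: closed(3)[rotated 2])
    then show "ring ?F"
      by (intro ringI group) (simp_all add: tree_mult_linear)
  qed (auto simp: tree_mult_linear B_plus_linear tree_mult_B_plus dest: closed(4)[rotated 2])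
qed

lemma lambda_ETS_if_omega_rba:
  assumes "omega_rba \<Omega> (tree_algebra \<Omega> Gen) B_plus" "x \<in> Gen"
  shows "lambda_ETS \<Omega>"
proof -
  interpret omega_rba \<Omega> "tree_algebra \<Omega> Gen" B_plus by fact
  have "Node Leaf [(x, Leaf)] \<in> trees (carrier \<Omega>) Gen"
    using assms(2) by (simp add: trees_def)
  then show ?thesis
    using m_assoc by (intro lambda_ETS_if_assoc[of x]) simp
qed


section \<open>The universal property\<close>

text \<open>These values are forced on any unitary morphism that commutes with the operators and
  extends \<open>f\<close>. The branches are evaluated by \<open>map\<close> before the fold so that
  the recursion stays primitive through the nested list of pairs.\<close>

primrec tree_eval and branch_eval where
  "tree_eval A P f (Node b l) = branch_eval A P f b \<otimes>\<^bsub>A\<^esub>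
    foldr (\<lambda>(x, r) s. f x \<otimes>\<^bsub>A\<^esub> r \<otimes>\<^bsub>A\<^esub> s) (map (map_prod id (branch_eval A P f)) l) \<one>\<^bsub>A\<^esub>"
| "branch_eval A P f Leaf = \<one>\<^bsub>A\<^esub>"
| "branch_eval A P f (Edge \<omega> T) = P \<omega> (tree_eval A P f T)"

text \<open>The target is a record with a carrier, so the sum is taken inside \<open>A\<close>;
  \<open>lin_ext\<close> takes its values in another free module.\<close>

definition module_ext :: "('k::comm_ring_1, 'a) module \<Rightarrow> ('b \<Rightarrow> 'a) \<Rightarrow> ('b \<Rightarrow>\<^sub>0 'k) \<Rightarrow> 'a"
  where "module_ext A e p = (\<Oplus>\<^bsub>A\<^esub>a\<in>Poly_Mapping.keys p. Poly_Mapping.lookup p a \<odot>\<^bsub>A\<^esub> e a)"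

lemma trees_Node:
  "Node b l \<in> trees W Gen \<longleftrightarrow> angles_branch b \<subseteq> Gen \<and> edges_branch b \<subseteq> W
    \<and> (\<forall>(x, c)\<in>set l. x \<in> Gen \<and> angles_branch c \<subseteq> Gen \<and> edges_branch c \<subseteq> W)"
  by (auto simp: trees_def UN_subset_iff Ball_def) blast+

context omega_rba
begin

section \<open>Linear maps from a free module into the algebra\<close>

context
  fixes e :: "'b \<Rightarrow> 'a" and S :: "'b set"
  assumes e: "e \<in> S \<rightarrow> carrier A"
begin

lemma ext_closed: "\<lbrakk>a \<in> B; B \<subseteq> S\<rbrakk> \<Longrightarrow> e a \<in> carrier A"
  using e by auto

lemma module_ext_superset:
  assumes "finite B" "Poly_Mapping.keys p \<subseteq> B" "B \<subseteq> S"
  shows "module_ext A e p = (\<Oplus>\<^bsub>A\<^esub>a\<in>B. Poly_Mapping.lookup p a \<odot>\<^bsub>A\<^esub> e a)"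
  unfolding module_ext_def using assms ext_closed[OF _ assms(3)]
  by (intro M.add.finprod_mono_neutral_cong_left) (auto simp: in_keys_iff smult_l_null[simplified])

lemma module_ext_closed: "Poly_Mapping.keys p \<subseteq> S \<Longrightarrow> module_ext A e p \<in> carrier A"
  unfolding module_ext_def by (intro M.finsum_closed) (auto simp: ext_closed)

lemma module_ext_single:
  assumes "a \<in> S" shows "module_ext A e (Poly_Mapping.single a c) = c \<odot>\<^bsub>A\<^esub> e a"
proof -
  have "e a \<in> carrier A" using assms e by auto
  then show ?thesis
    using assms by (subst module_ext_superset[of "{a}"]) auto
qed

lemma module_ext_add:
  assumes "Poly_Mapping.keys p \<subseteq> S" "Poly_Mapping.keys q \<subseteq> S"
  shows "module_ext A e (p + q) = module_ext A e p \<oplus>\<^bsub>A\<^esub> module_ext A e q"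
proof -
  let ?B = "Poly_Mapping.keys p \<union> Poly_Mapping.keys q"
  have closed: "e a \<in> carrier A" if "a \<in> ?B" for a
    using that assms by (intro ext_closed[of _ ?B]) auto
  have ext: "module_ext A e r = (\<Oplus>\<^bsub>A\<^esub>a\<in>?B. Poly_Mapping.lookup r a \<odot>\<^bsub>A\<^esub> e a)"
    if "r \<in> {p, q, p + q}" for r
    using that assms keys_add[of p q] by (intro module_ext_superset) auto
  have "(\<Oplus>\<^bsub>A\<^esub>a\<in>?B. Poly_Mapping.lookup (p + q) a \<odot>\<^bsub>A\<^esub> e a)
      = (\<Oplus>\<^bsub>A\<^esub>a\<in>?B. Poly_Mapping.lookup p a \<odot>\<^bsub>A\<^esub> e a \<oplus>\<^bsub>A\<^esub> Poly_Mapping.lookup q a \<odot>\<^bsub>A\<^esub> e a)"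
    using closed by (intro M.finsum_cong') (auto simp: lookup_add smult_l_distr[simplified])
  also have "\<dots> = (\<Oplus>\<^bsub>A\<^esub>a\<in>?B. Poly_Mapping.lookup p a \<odot>\<^bsub>A\<^esub> e a)
      \<oplus>\<^bsub>A\<^esub> (\<Oplus>\<^bsub>A\<^esub>a\<in>?B. Poly_Mapping.lookup q a \<odot>\<^bsub>A\<^esub> e a)"
    using closed by (intro M.finsum_addf) auto
  finally show ?thesis
    by (simp add: ext)
qed

lemma module_ext_scale:
  assumes "Poly_Mapping.keys p \<subseteq> S"
  shows "module_ext A e (scale c p) = c \<odot>\<^bsub>A\<^esub> module_ext A e p"
proof -
  have "module_ext A e (scale c p)
      = (\<Oplus>\<^bsub>A\<^esub>a\<in>Poly_Mapping.keys p. (c * Poly_Mapping.lookup p a) \<odot>\<^bsub>A\<^esub> e a)"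
    using assms by (subst module_ext_superset[OF _ keys_scale]) auto
  also have "\<dots> = (\<Oplus>\<^bsub>A\<^esub>a\<in>Poly_Mapping.keys p. c \<odot>\<^bsub>A\<^esub> (Poly_Mapping.lookup p a \<odot>\<^bsub>A\<^esub> e a))"
    using ext_closed[OF _ assms] by (intro M.finsum_cong') (auto simp: smult_assoc1[simplified])
  also have "\<dots> = c \<odot>\<^bsub>A\<^esub> module_ext A e p"
    unfolding module_ext_def using ext_closed[OF _ assms]
    by (intro finsum_smult_ldistr[symmetric]) auto
  finally show ?thesis .
qed

end

section \<open>Evaluation of trees as a morphism\<close>

context
  fixes f :: "'x \<Rightarrow> 'a" and Gen :: "'x set"
  assumes f: "f \<in> Gen \<rightarrow> carrier A"
begin

abbreviation \<phi> where "\<phi> \<equiv> tree_eval A P f"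
abbreviation \<Phi> where "\<Phi> \<equiv> module_ext A \<phi>"
abbreviation Trees where "Trees \<equiv> trees (carrier \<Omega>) Gen"

lemma foldr_closed:
  assumes "\<And>x r. (x, r) \<in> set l \<Longrightarrow> f x \<in> carrier A \<and> r \<in> carrier A" "s \<in> carrier A"
  shows "foldr (\<lambda>(x, r) s. f x \<otimes>\<^bsub>A\<^esub> r \<otimes>\<^bsub>A\<^esub> s) l s \<in> carrier A"
  using assms by (induction l) auto

lemma tree_eval_closed: "T \<in> Trees \<Longrightarrow> \<phi> T \<in> carrier A"
  and branch_eval_closed:
    "\<lbrakk>angles_branch b \<subseteq> Gen; edges_branch b \<subseteq> carrier \<Omega>\<rbrakk> \<Longrightarrow> branch_eval A P f b \<in> carrier A"
proof (induction T and b)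
  case (Node b l)
  have "branch_eval A P f b \<in> carrier A"
    using Node by (auto simp: trees_Node)
  moreover have "f x \<in> carrier A \<and> branch_eval A P f c \<in> carrier A" if "(x, c) \<in> set l" for x c
  proof -
    have "x \<in> Gen" "angles_branch c \<subseteq> Gen" "edges_branch c \<subseteq> carrier \<Omega>"
      using that Node.prems by (auto simp: trees_Node)
    with that show ?thesis using Node.IH(2)[of "(x, c)" c] f by auto
  qed
  ultimately show ?case
    by (auto intro!: m_closed foldr_closed)
qed (auto simp: trees_def P_closed)

lemma tree_eval_graft:
  "\<lbrakk>\<omega> \<in> carrier \<Omega>; S \<in> Trees\<rbrakk> \<Longrightarrow> \<phi> (graft \<omega> S) = P \<omega> (\<phi> S)"
  by (simp add: graft_def P_closed tree_eval_closed)

text \<open>Evaluating a concatenated list starts the fold at the value of the remaining word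
  instead of at 1. Associativity in \<open>A\<close> extracts that value as a right factor, which
  makes evaluation multiplicative at every cut.\<close>

lemma foldr_mult:
  assumes "\<And>x r. (x, r) \<in> set l \<Longrightarrow> f x \<in> carrier A \<and> r \<in> carrier A" "s \<in> carrier A"
  shows "foldr (\<lambda>(x, r) s. f x \<otimes>\<^bsub>A\<^esub> r \<otimes>\<^bsub>A\<^esub> s) l s
    = foldr (\<lambda>(x, r) s. f x \<otimes>\<^bsub>A\<^esub> r \<otimes>\<^bsub>A\<^esub> s) l \<one>\<^bsub>A\<^esub> \<otimes>\<^bsub>A\<^esub> s"
  using assms
proof (induction l)
  case (Cons xr l)
  obtain x r where xr: "xr = (x, r)" by (cases xr)
  have "foldr (\<lambda>(x, r) s. f x \<otimes>\<^bsub>A\<^esub> r \<otimes>\<^bsub>A\<^esub> s) l \<one>\<^bsub>A\<^esub> \<in> carrier A"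
    using Cons.prems by (intro foldr_closed) auto
  moreover have "f x \<in> carrier A" "r \<in> carrier A"
    using Cons.prems(1)[of x r] by (simp_all add: xr)
  moreover have "foldr (\<lambda>(x, r) s. f x \<otimes>\<^bsub>A\<^esub> r \<otimes>\<^bsub>A\<^esub> s) l s
      = foldr (\<lambda>(x, r) s. f x \<otimes>\<^bsub>A\<^esub> r \<otimes>\<^bsub>A\<^esub> s) l \<one>\<^bsub>A\<^esub> \<otimes>\<^bsub>A\<^esub> s"
    by (rule Cons.IH) (use Cons.prems in auto)
  ultimately show ?case
    using Cons.prems(2) by (simp add: xr m_assoc)
qed simp

lemma tree_eval_cat:
  assumes "U \<in> Trees" "x \<in> Gen" "V \<in> Trees"
  shows "\<phi> (tree_cat U x V) = \<phi> U \<otimes>\<^bsub>A\<^esub> f x \<otimes>\<^bsub>A\<^esub> \<phi> V"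
proof (cases U; cases V)
  fix b l b' l' assume U: "U = Node b l" and V: "V = Node b' l'"
  let ?r = "map (map_prod id (branch_eval A P f))"
  let ?F = "foldr (\<lambda>(x, r) s. f x \<otimes>\<^bsub>A\<^esub> r \<otimes>\<^bsub>A\<^esub> s)"
  have closed: "f y \<in> carrier A \<and> r \<in> carrier A" if "(y, r) \<in> set (?r k)" "set k \<subseteq> set l \<union> set l'"
    for y r k
  proof -
    from that obtain c where c: "r = branch_eval A P f c" "(y, c) \<in> set l \<union> set l'" by auto
    then have "y \<in> Gen" "angles_branch c \<subseteq> Gen" "edges_branch c \<subseteq> carrier \<Omega>"
      using assms by (auto simp: U V trees_Node)
    then show ?thesis using c f branch_eval_closed by auto
  qed
  have b: "branch_eval A P f b \<in> carrier A" "branch_eval A P f b' \<in> carrier A"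
    using assms by (auto simp: U V trees_Node intro!: branch_eval_closed)
  have x: "f x \<in> carrier A" using assms f by auto
  have l: "?F (?r l) \<one>\<^bsub>A\<^esub> \<in> carrier A" "?F (?r l') \<one>\<^bsub>A\<^esub> \<in> carrier A"
    using closed by (auto intro!: foldr_closed)
  have "\<phi> (tree_cat U x V) = branch_eval A P f b \<otimes>\<^bsub>A\<^esub>
      ?F (?r l) (f x \<otimes>\<^bsub>A\<^esub> branch_eval A P f b' \<otimes>\<^bsub>A\<^esub> ?F (?r l') \<one>\<^bsub>A\<^esub>)"
    by (simp add: U V)
  also have "?F (?r l) (f x \<otimes>\<^bsub>A\<^esub> branch_eval A P f b' \<otimes>\<^bsub>A\<^esub> ?F (?r l') \<one>\<^bsub>A\<^esub>)
      = ?F (?r l) \<one>\<^bsub>A\<^esub> \<otimes>\<^bsub>A\<^esub> (f x \<otimes>\<^bsub>A\<^esub> branch_eval A P f b' \<otimes>\<^bsub>A\<^esub> ?F (?r l') \<one>\<^bsub>A\<^esub>)"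
    using closed b x l by (intro foldr_mult) auto
  finally show ?thesis
    using b x l by (simp add: U V m_assoc)
qed

lemma tree_eval_funcset: "\<phi> \<in> Trees \<rightarrow> carrier A"
  by (auto intro: tree_eval_closed)

lemmas \<Phi>_closed = module_ext_closed[OF tree_eval_funcset]
  and \<Phi>_add = module_ext_add[OF tree_eval_funcset]
  and \<Phi>_scale = module_ext_scale[OF tree_eval_funcset]

lemma \<Phi>_0: "\<Phi> 0 = \<zero>\<^bsub>A\<^esub>"
  by (simp add: module_ext_def)

lemma \<Phi>_vec: "T \<in> Trees \<Longrightarrow> \<Phi> (tree_vec T) = \<phi> T"
  unfolding tree_vec_def
  by (simp add: module_ext_single[OF tree_eval_funcset] tree_eval_closed smult_one[simplified])

text \<open>An operation on trees that evaluation turns into a linear map of \<open>A\<close> does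
  so for vectors as well. It is applied with \<open>L\<close> an operator \<open>P \<omega>\<close>,
  left multiplication by the part before a cut, and right multiplication by the part after
  it.\<close>

lemma \<Phi>_lin_ext:
  assumes p: "Poly_Mapping.keys p \<subseteq> Trees"
    and h: "\<And>T. T \<in> Trees \<Longrightarrow> h T \<in> Trees"
    and L: "\<And>T. T \<in> Trees \<Longrightarrow> \<phi> (h T) = L (\<phi> T)"
    and L_add: "\<And>a b. \<lbrakk>a \<in> carrier A; b \<in> carrier A\<rbrakk> \<Longrightarrow> L (a \<oplus>\<^bsub>A\<^esub> b) = L a \<oplus>\<^bsub>A\<^esub> L b"
    and L_smult: "\<And>c a. a \<in> carrier A \<Longrightarrow> L (c \<odot>\<^bsub>A\<^esub> a) = c \<odot>\<^bsub>A\<^esub> L a"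
    and L_closed: "\<And>a. a \<in> carrier A \<Longrightarrow> L a \<in> carrier A"
  shows "\<Phi> (lin_ext (\<lambda>T. tree_vec (h T)) p) = L (\<Phi> p)"
proof -
  have keys: "Poly_Mapping.keys (lin_ext (\<lambda>T. tree_vec (h T)) p) \<subseteq> Trees"
    if "Poly_Mapping.keys p \<subseteq> Trees" for p :: "('x, 'w) tree \<Rightarrow>\<^sub>0 'k"
    using that by (rule keys_lin_ext) (simp add: h)
  show ?thesis
    using p
  proof (induction rule: free_module_induct)
    case zero
    \<comment> \<open>That \<open>L\<close> preserves zero follows from homogeneity with the scalar
      0.\<close>
    have "L \<zero>\<^bsub>A\<^esub> = L (0 \<odot>\<^bsub>A\<^esub> \<zero>\<^bsub>A\<^esub>)"
      by (simp add: smult_l_null[simplified])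
    also have "\<dots> = \<zero>\<^bsub>A\<^esub>"
      by (subst L_smult) (simp_all add: L_closed smult_l_null[simplified])
    finally show ?case by (simp add: \<Phi>_0)
  next
    case (basis T)
    then show ?case
      by (simp add: L h \<Phi>_vec flip: tree_vec_def)
  next
    case (scale c p)
    then show ?case by (simp add: lin_ext_scale \<Phi>_scale keys L_smult \<Phi>_closed)
  next
    case (add p q)
    then show ?case by (simp add: lin_ext_add \<Phi>_add keys L_add \<Phi>_closed)
  qed
qed

lemma \<Phi>_B_plus:
  "\<lbrakk>\<omega> \<in> carrier \<Omega>; Poly_Mapping.keys p \<subseteq> Trees\<rbrakk> \<Longrightarrow> \<Phi> (B_plus \<omega> p) = P \<omega> (\<Phi> p)"
  unfolding B_plus_def
  by (rule \<Phi>_lin_ext) (simp_all add: tree_eval_graft P_add P_smult P_closed)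

text \<open>Both sides satisfy the same recursion: at a cut by associativity in \<open>A\<close>,
  and for two grafts because the Rota-Baxter identity of \<open>A\<close> has the three terms of
  \<open>diamond_graft\<close>. Associativity of the product of trees is not involved.\<close>

lemma \<Phi>_diamond:
  assumes "T \<in> Trees" "T' \<in> Trees"
  shows "\<Phi> (diamond \<Omega> T T') = \<phi> T \<otimes>\<^bsub>A\<^esub> \<phi> T'"
  using assms
proof (induction "size T + size T'" arbitrary: T T' rule: less_induct)
  case less
  show ?case
  proof (cases T rule: tree_cases)
    case unit
    then show ?thesis using less.prems by (simp add: \<Phi>_vec tree_eval_closed)
  next
    case (cat U x V)
    have trees: "U \<in> Trees" "x \<in> Gen" "V \<in> Trees"
      using less.prems cat by auto
    have x: "f x \<in> carrier A" using trees f by auto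
    have "\<Phi> (diamond \<Omega> T T') = \<phi> U \<otimes>\<^bsub>A\<^esub> f x \<otimes>\<^bsub>A\<^esub> \<Phi> (diamond \<Omega> V T')"
      unfolding cat diamond_cat_left using trees less.prems x
      by (intro \<Phi>_lin_ext[where L = "\<lambda>a. \<phi> U \<otimes>\<^bsub>A\<^esub> f x \<otimes>\<^bsub>A\<^esub> a"])
        (auto simp: keys_diamond tree_eval_cat tree_eval_closed r_distr smult_mult_right)
    also have "\<Phi> (diamond \<Omega> V T') = \<phi> V \<otimes>\<^bsub>A\<^esub> \<phi> T'"
      using trees less.prems cat by (intro less.hyps) auto
    finally show ?thesis
      using trees less.prems x by (simp add: cat tree_eval_cat m_assoc tree_eval_closed)
  next
    case T: (graft \<alpha> S)
    show ?thesis
    proof (cases T' rule: tree_cases)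
      case unit
      then show ?thesis using less.prems by (simp add: \<Phi>_vec tree_eval_closed)
    next
      case (cat U x V)
      have trees: "U \<in> Trees" "x \<in> Gen" "V \<in> Trees"
        using less.prems cat by auto
      have x: "f x \<in> carrier A" using trees f by auto
      have "\<Phi> (diamond \<Omega> T T') = \<Phi> (diamond \<Omega> T U) \<otimes>\<^bsub>A\<^esub> f x \<otimes>\<^bsub>A\<^esub> \<phi> V"
        unfolding cat diamond_cat_right using trees less.prems x
        by (intro \<Phi>_lin_ext[where L = "\<lambda>a. a \<otimes>\<^bsub>A\<^esub> f x \<otimes>\<^bsub>A\<^esub> \<phi> V"])
          (auto simp: keys_diamond tree_eval_cat tree_eval_closed l_distr smult_mult_left)
      also have "\<Phi> (diamond \<Omega> T U) = \<phi> T \<otimes>\<^bsub>A\<^esub> \<phi> U"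
        using trees less.prems cat by (intro less.hyps) auto
      finally show ?thesis
        using trees less.prems x by (simp add: cat tree_eval_cat m_assoc tree_eval_closed)
    next
      case T': (graft \<beta> S')
      have labels: "\<alpha> \<in> carrier \<Omega>" "\<beta> \<in> carrier \<Omega>" and trees: "S \<in> Trees" "S' \<in> Trees"
        using less.prems T T' by auto
      note label_closed = labels lft_closed rgt_closed ltri_closed rtri_closed dot_closed
      have IH: "\<Phi> (diamond \<Omega> (graft (\<alpha> \<triangleright>\<^bsub>\<Omega>\<^esub> \<beta>) S) S') = P (\<alpha> \<triangleright>\<^bsub>\<Omega>\<^esub> \<beta>) (\<phi> S) \<otimes>\<^bsub>A\<^esub> \<phi> S'"
        "\<Phi> (diamond \<Omega> S (graft (\<alpha> \<triangleleft>\<^bsub>\<Omega>\<^esub> \<beta>) S')) = \<phi> S \<otimes>\<^bsub>A\<^esub> P (\<alpha> \<triangleleft>\<^bsub>\<Omega>\<^esub> \<beta>) (\<phi> S')"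
        "\<Phi> (diamond \<Omega> S S') = \<phi> S \<otimes>\<^bsub>A\<^esub> \<phi> S'"
        using less.hyps[of "graft (\<alpha> \<triangleright>\<^bsub>\<Omega>\<^esub> \<beta>) S" S'] less.hyps[of S "graft (\<alpha> \<triangleleft>\<^bsub>\<Omega>\<^esub> \<beta>) S'"]
          less.hyps[of S S'] trees
        by (simp_all add: T T' label_closed tree_eval_graft)
      have keys: "Poly_Mapping.keys (B_plus (\<alpha> \<rightharpoonup>\<^bsub>\<Omega>\<^esub> \<beta>) (diamond \<Omega> (graft (\<alpha> \<triangleright>\<^bsub>\<Omega>\<^esub> \<beta>) S) S')) \<subseteq> Trees"
        "Poly_Mapping.keys (B_plus (\<alpha> \<leftharpoonup>\<^bsub>\<Omega>\<^esub> \<beta>) (diamond \<Omega> S (graft (\<alpha> \<triangleleft>\<^bsub>\<Omega>\<^esub> \<beta>) S'))) \<subseteq> Trees"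
        "Poly_Mapping.keys (B_plus (\<alpha> \<bullet>\<^bsub>\<Omega>\<^esub> \<beta>) (diamond \<Omega> S S')) \<subseteq> Trees"
        by (intro keys_B_plus keys_diamond; simp add: trees label_closed)+
      then show ?thesis
        using trees unfolding T T' diamond_graft
        by (simp add: \<Phi>_add \<Phi>_scale \<Phi>_B_plus keys_diamond label_closed IH rota_baxter
            tree_eval_graft tree_eval_closed order_trans[OF keys_add] order_trans[OF keys_scale])
    qed
  qed
qed

lemma \<Phi>_mult:
  assumes "Poly_Mapping.keys p \<subseteq> Trees" "Poly_Mapping.keys q \<subseteq> Trees"
  shows "\<Phi> (tree_mult \<Omega> p q) = \<Phi> p \<otimes>\<^bsub>A\<^esub> \<Phi> q"
  using assms(1)
proof (induction rule: free_module_induct)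
  case zero
  then show ?case by (simp add: tree_mult_def \<Phi>_0 \<Phi>_closed assms(2))
next
  case (basis T)
  show ?case
    using assms(2)
  proof (induction rule: free_module_induct)
    case zero
    then show ?case
      using basis by (simp add: tree_mult_def lin_ext_single \<Phi>_0 \<Phi>_vec tree_eval_closed
          flip: tree_vec_def)
  next
    case (basis T')
    with \<open>T \<in> Trees\<close> show ?case
      by (simp add: \<Phi>_vec \<Phi>_diamond tree_mult_vec flip: tree_vec_def)
  next
    case (scale c q)
    with basis show ?case
      by (simp add: tree_mult_linear \<Phi>_scale keys_tree_mult \<Phi>_closed smult_mult_right)
  next
    case (add q q')
    with basis show ?case
      by (simp add: tree_mult_linear \<Phi>_add keys_tree_mult \<Phi>_closed r_distr)
  qed
next
  case (scale c p)
  with assms(2) show ?case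
    by (simp add: tree_mult_linear \<Phi>_scale keys_tree_mult \<Phi>_closed smult_mult_left)
next
  case (add p p')
  with assms(2) show ?case
    by (simp add: tree_mult_linear \<Phi>_add keys_tree_mult \<Phi>_closed l_distr)
qed

lemma \<Phi>_hom:
  "restrict \<Phi> (carrier (tree_algebra \<Omega> Gen))
    \<in> rba_hom \<Omega> (tree_algebra \<Omega> Gen) B_plus A P"
  by (auto simp: rba_hom_def ring_hom_def \<Phi>_mult \<Phi>_add \<Phi>_scale \<Phi>_vec \<Phi>_B_plus \<Phi>_closed
      subsetD[OF keys_tree_mult] subsetD[OF keys_B_plus]
      dest: subsetD[OF keys_add] subsetD[OF keys_scale])

lemma \<Phi>_gen:
  assumes "x \<in> Gen" shows "\<Phi> (tree_gen x) = f x"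
proof -
  have "f x \<in> carrier A" using assms f by auto
  then show ?thesis
    using assms by (simp add: tree_gen_def \<Phi>_vec trees_def)
qed

text \<open>Every tree is obtained from the unit and the generators by products and grafting, and a
  morphism respects these operations, so its values on the generators determine it on trees and
  then, by linearity, on all of the carrier.\<close>

lemma rba_hom_unique:
  assumes g: "g \<in> rba_hom \<Omega> (tree_algebra \<Omega> Gen) B_plus A P"
    and gen: "\<And>x. x \<in> Gen \<Longrightarrow> g (tree_gen x) = f x"
    and p: "Poly_Mapping.keys p \<subseteq> Trees"
  shows "g p = \<Phi> p"
proof -
  let ?F = "tree_algebra \<Omega> Gen"
  have hom: "g p \<in> carrier A" "g (p + q) = g p \<oplus>\<^bsub>A\<^esub> g q" "g (scale c p) = c \<odot>\<^bsub>A\<^esub> g p"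
    "g (tree_mult \<Omega> p q) = g p \<otimes>\<^bsub>A\<^esub> g q" "g (tree_vec tree_unit) = \<one>\<^bsub>A\<^esub>"
    "\<omega> \<in> carrier \<Omega> \<Longrightarrow> g (B_plus \<omega> p) = P \<omega> (g p)"
    if "Poly_Mapping.keys p \<subseteq> Trees" "Poly_Mapping.keys q \<subseteq> Trees" for p q c \<omega>
    using g that unfolding rba_hom_def ring_hom_def by auto
  have vec: "g (tree_vec T) = \<phi> T" if "T \<in> Trees" for T
    using that
  proof (induction rule: trees_induct)
    case unit
    \<comment> \<open>The facts \<open>hom\<close> carry support conditions on two vectors even
      where the conclusion mentions fewer; the zero vector, with empty support, fills the spare
      places.\<close>
    show ?case using hom(5)[of 0 0] by simp
  next
    case (graft \<omega> S)
    then show ?case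
      using hom(6)[of "tree_vec S" 0 \<omega>] by (simp add: B_plus_vec tree_eval_graft)
  next
    case (cat U x V)
    \<comment> \<open>A cut is a genuine product with the generator in the middle, which is what
      lets \<open>g\<close> be applied factor by factor.\<close>
    have "tree_vec (tree_cat U x V) = tree_mult \<Omega> (tree_mult \<Omega> (tree_vec U) (tree_gen x)) (tree_vec V)"
      by (simp add: tree_gen_eq_cat_vec tree_mult_cat_left tree_mult_cat_right flip: cat_vec_vec)
    moreover have keys: "Poly_Mapping.keys (tree_gen x :: ('x, 'w) tree \<Rightarrow>\<^sub>0 'k) \<subseteq> Trees"
      using cat by (simp add: tree_gen_def trees_def)
    ultimately show ?case
      using cat by (simp add: hom(4) keys_tree_mult gen tree_eval_cat)
  qed
  show ?thesis
    using p
  proof (induction rule: free_module_induct)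
    case zero
    show ?case
      using hom(1)[of 0 0] hom(3)[of 0 0 0] by (simp add: \<Phi>_0 smult_l_null[simplified])
  next
    case (scale c p)
    then show ?case using hom(3)[of p 0] by (simp add: \<Phi>_scale)
  qed (simp_all add: hom(2) \<Phi>_add vec \<Phi>_vec flip: tree_vec_def)
qed

end

end

text \<open>The assumption gives the first clause of freeness. The extension rests on the identities
  of the target and its uniqueness on the generation of trees by the generators, so no axiom on the
  labels is consulted. Restricting the evaluation to the carrier makes it extensional.\<close>

lemma free_rba_on_tree_algebra:
  assumes "omega_rba \<Omega> (tree_algebra \<Omega> Gen) B_plus"
  shows "free_rba_on TYPE('r) \<Omega> Gen (tree_algebra \<Omega> Gen) B_plus tree_gen"
proof -
  have gen: "tree_gen x \<in> carrier (tree_algebra \<Omega> Gen)" if "x \<in> Gen" for x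
    using that by (simp add: tree_gen_def trees_def)
  show ?thesis
    unfolding free_rba_on_def
  proof (intro conjI allI impI assms)
    show "tree_gen \<in> Gen \<rightarrow> carrier (tree_algebra \<Omega> Gen)"
      using gen by auto
    fix R :: "('b, 'r) module" and Q and f :: "'c \<Rightarrow> 'r"
    assume "omega_rba \<Omega> R Q \<and> f \<in> Gen \<rightarrow> carrier R"
    then have R: "omega_rba \<Omega> R Q" and f: "f \<in> Gen \<rightarrow> carrier R" by auto
    let ?F = "tree_algebra \<Omega> Gen"
    let ?g = "restrict (module_ext R (tree_eval R Q f)) (carrier ?F)"
    show "\<exists>!g. g \<in> rba_hom \<Omega> ?F B_plus R Q \<and> g \<in> extensional (carrier ?F) \<and>
        (\<forall>x\<in>Gen. g (tree_gen x) = f x)"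
    proof (rule ex1I[of _ ?g])
      show "?g \<in> rba_hom \<Omega> ?F B_plus R Q \<and> ?g \<in> extensional (carrier ?F) \<and>
          (\<forall>x\<in>Gen. ?g (tree_gen x) = f x)"
        using omega_rba.\<Phi>_hom[OF R f] omega_rba.\<Phi>_gen[OF R f] gen
        by (simp del: tree_algebra_simps)
    next
      fix g assume g: "g \<in> rba_hom \<Omega> ?F B_plus R Q \<and> g \<in> extensional (carrier ?F) \<and>
          (\<forall>x\<in>Gen. g (tree_gen x) = f x)"
      show "g = ?g"
      proof (rule extensionalityI[of _ "carrier ?F"])
        fix p assume "p \<in> carrier ?F"
        then show "g p = ?g p"
          using omega_rba.rba_hom_unique[OF R f, of g p] g by simp
      qed (use g in auto)
    qed
  qed
qed

theorem theorem2p14: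
  fixes \<Omega> :: "('w, 'k::comm_ring_1) omega" and Gen :: "'x set"
  assumes "omega_set \<Omega>" and "Gen \<noteq> {}"
  shows "(free_rba_on TYPE('r) \<Omega> Gen (tree_algebra \<Omega> Gen) B_plus tree_gen
            \<longleftrightarrow> omega_rba \<Omega> (tree_algebra \<Omega> Gen) B_plus)
       \<and> (omega_rba \<Omega> (tree_algebra \<Omega> Gen) B_plus \<longleftrightarrow> lambda_ETS \<Omega>)"
proof (intro conjI iffI)
  assume "free_rba_on TYPE('r) \<Omega> Gen (tree_algebra \<Omega> Gen) B_plus tree_gen"
  then show "omega_rba \<Omega> (tree_algebra \<Omega> Gen) B_plus"
    by (simp add: free_rba_on_def)
next
  assume "omega_rba \<Omega> (tree_algebra \<Omega> Gen) B_plus"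
  then show "free_rba_on TYPE('r) \<Omega> Gen (tree_algebra \<Omega> Gen) B_plus tree_gen"
    by (rule free_rba_on_tree_algebra)
next
  assume "omega_rba \<Omega> (tree_algebra \<Omega> Gen) B_plus"
  moreover obtain x where "x \<in> Gen" using assms(2) by blast
  ultimately show "lambda_ETS \<Omega>" by (rule lambda_ETS_if_omega_rba)
next
  assume "lambda_ETS \<Omega>"
  then show "omega_rba \<Omega> (tree_algebra \<Omega> Gen) B_plus"
    by (rule lambda_ETS.omega_rba_tree_algebra)
qed

end
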